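(* Let $\xi \in \mathcal{D}_1$ and let $N$ be an arbitrary non-negative integer. Let $\mu$ and $\nu$ be complex numbers satisfying $|\Re\mu | < N + \frac{1}{2}$ and $\Re\nu > N - \frac{1}{2}$. Then $$e^{-\pi i\mu }Q_\nu ^\mu (\cosh \xi ) = \frac{\sqrt{\frac{\pi}{2\sinh \xi } }\, e^{ - \left(\nu+\frac{1}{2}\right) \xi}}{\Gamma (\nu - \mu + 1)} \left( \sum_{n = 0}^{N - 1} a_n (\mu )\Gamma \left( \nu - n + \tfrac{1}{2} \right)\left( \frac{e^\xi }{\sinh \xi } \right)^n + R_N^{(Q)} (\xi ,\mu ,\nu ) \right) ,$$ where the remainder term satisfies the estimate $$\left| R_N^{(Q)} (\xi ,\mu ,\nu ) \right| \le \left| \frac{\cos (\pi \mu ) }{\cos (\pi \Re\mu ) }\right|\left| a_N (\Re\mu ) \right| \Gamma \left( \Re\nu - N + \tfrac{1}{2} \right) \left| \frac{e^\xi }{\sinh \xi } \right|^N.$$ If $2\Re\mu $ is an odd integer, then the limiting value has to be taken in this bound. The square root is positive for positive real $\xi$ and is defined by continuity elsewhere. In addition, $R_N^{(Q)} (\xi ,\mu ,\nu )$ does not exceed the corresponding first neglected term $a_N(\mu)\Gamma(\nu-N+\frac12)\left(\frac{e^\xi}{\sinh\xi}\right)^N$ in absolute value and has the same sign, provided that $\xi$ is positive, $\mu$ and $\nu$ are real, $|\mu| <N + \frac{1}{2}$ and $\nu > N - \frac{1}{2}$.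
   Context: $\mathcal{D}_1=\{\xi\in\mathbb{C} : \Re \xi>0,\ |\Im \xi |<\pi\}$; $\cosh$ maps $\mathcal{D}_1$ biholomorphically onto $\mathbb{C}\setminus(-\infty,1]$. The associated Legendre function of the second kind is defined, for $z\in\mathbb{C}\setminus(-\infty,1]$ and $\nu+\mu\notin\mathbb{Z}_{<0}$, by $$e^{-\pi i\mu }Q_\nu ^\mu (z) = \frac{\pi ^{1/2} \Gamma (\nu +\mu + 1)(z^2 - 1)^{\mu /2} }{2^{\nu + 1} z^{\nu +\mu + 1}}\mathbf{F}\left(\tfrac{\nu+\mu+2}{2},\tfrac{\nu+\mu+1}{2};\nu+\tfrac32;\tfrac{1}{z^2}\right),$$ with powers positive-based for $z>1$ and continued by analyticity, where $\mathbf{F}(a,b;c;w)$ is the regularised hypergeometric function, $\mathbf{F}(a,b;c;w)=\sum_{n\ge 0}\frac{(a)_n(b)_n}{\Gamma(c+n)\,n!}w^n$ for $|w|<1$, continued analytically to $w\in\mathbb{C}\setminus[1,+\infty)$. $a_n (\mu ) = \frac{(4\mu ^2 - 1^2 )(4\mu ^2 - 3^2 ) \cdots (4\mu ^2 - (2n - 1)^2 )}{8^n n!}=\frac{(\frac12-\mu)_n(\frac12+\mu)_n}{(-2)^n n!}$, with $(\cdot)_n$ the Pochhammer symbol. "Limiting value" means that $|a_N(\Re\mu)|/|\cos(\pi\Re\mu)|$ is replaced by $\lim_{x\to\Re\mu}|a_N(x)|/|\cos(\pi x)|$. *)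

theory Defs
  imports "HOL-Complex_Analysis.Complex_Analysis"
begin

definition D1 :: "complex set" where
  "D1 = {\<xi>. Re \<xi> > 0 \<and> \<bar>Im \<xi>\<bar> < pi}"

text \<open>
  The analytic continuation is unique because the slit plane is connected; the values on the
  cut \<open>[1, \<infinity>)\<close> are unspecified. The factor \<open>rGamma\<close> is the entire function \<open>1/\<Gamma>\<close>, so the
  series is meaningful for every \<open>c\<close>.
\<close>
definition hyp2F1_reg :: "complex \<Rightarrow> complex \<Rightarrow> complex \<Rightarrow> complex \<Rightarrow> complex" where
  "hyp2F1_reg a b c = (SOME f. f holomorphic_on (UNIV - complex_of_real ` {1..}) \<and>
     (\<forall>w. norm w < 1 \<longrightarrow>
        f w = (\<Sum>n. pochhammer a n * pochhammer b n * rGamma (c + of_nat n) / fact n * w ^ n)))"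

text \<open>
  Only used for \<open>z \<in> \<complex> - (-\<infinity>, 1]\<close> and \<open>\<nu> + \<mu>\<close> not a negative integer. On that domain
  \<open>(z - 1)\<^bsup>\<mu>/2\<^esup> (z + 1)\<^bsup>\<mu>/2\<^esup>\<close> with principal powers is the analytic continuation of
  \<open>(z\<^sup>2 - 1)\<^bsup>\<mu>/2\<^esup>\<close> from \<open>z > 1\<close>; the principal power of \<open>z\<^sup>2 - 1\<close> itself would be wrong
  for \<open>Re z \<le> 0\<close>.
\<close>
definition legendre_Q :: "complex \<Rightarrow> complex \<Rightarrow> complex \<Rightarrow> complex" where
  "legendre_Q \<nu> \<mu> z = exp (of_real pi * \<i> * \<mu>) *
     (of_real (sqrt pi) * Gamma (\<nu> + \<mu> + 1) * ((z - 1) powr (\<mu> / 2) * (z + 1) powr (\<mu> / 2)) /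
        (2 powr (\<nu> + 1) * z powr (\<nu> + \<mu> + 1)) *
      hyp2F1_reg ((\<nu> + \<mu> + 2) / 2) ((\<nu> + \<mu> + 1) / 2) (\<nu> + 3 / 2) (1 / z\<^sup>2))"

definition a_coeff :: "nat \<Rightarrow> 'a :: field_char_0 \<Rightarrow> 'a" where
  "a_coeff n \<mu> = (\<Prod>k=1..n. 4 * \<mu>\<^sup>2 - (2 * of_nat k - 1)\<^sup>2) / (8 ^ n * fact n)"

lemma a_coeff_pochhammer:
  "a_coeff n \<mu> = pochhammer (1/2 - \<mu>) n * pochhammer (1/2 + \<mu>) n / ((-2) ^ n * fact n)"
proof (induction n)
  case (Suc n)
  have "a_coeff (Suc n) \<mu> = a_coeff n \<mu> * ((4 * \<mu>\<^sup>2 - (2 * of_nat n + 1)\<^sup>2) / (8 * of_nat (Suc n)))"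
    by (simp add: a_coeff_def algebra_simps)
  also have "(4 * \<mu>\<^sup>2 - (2 * of_nat n + 1)\<^sup>2) / (8 * of_nat (Suc n)) =
      (1/2 - \<mu> + of_nat n) * (1/2 + \<mu> + of_nat n) / ((-2) * of_nat (Suc n))"
    by (simp add: divide_simps del: of_nat_Suc) (simp add: algebra_simps power2_eq_square)
  finally show ?case
    by (simp add: Suc.IH pochhammer_Suc mult_ac del: of_nat_Suc)
qed (simp add: a_coeff_def)

lemma legendre_power_branch:
  "(\<lambda>z. (z - 1) powr (\<mu> / 2) * (z + 1) powr (\<mu> / 2)) holomorphic_on
     (UNIV - complex_of_real ` {..1})"
  "x > 1 \<Longrightarrow> (complex_of_real x - 1) powr (\<mu> / 2) * (complex_of_real x + 1) powr (\<mu> / 2) =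
     complex_of_real (x\<^sup>2 - 1) powr (\<mu> / 2)"
proof -
  have *: "z \<in> complex_of_real ` {..1}" if "z - 1 \<in> \<real>\<^sub>\<le>\<^sub>0 \<or> z + 1 \<in> \<real>\<^sub>\<le>\<^sub>0" for z
    using that by (intro image_eqI[of _ _ "Re z"])
      (auto simp: complex_nonpos_Reals_iff complex_eq_iff)
  show "(\<lambda>z. (z - 1) powr (\<mu> / 2) * (z + 1) powr (\<mu> / 2)) holomorphic_on
     (UNIV - complex_of_real ` {..1})"
    by (intro holomorphic_intros) (use * in auto)
  assume x: "x > 1"
  have "(complex_of_real (x - 1) * complex_of_real (x + 1)) powr (\<mu> / 2) =
        complex_of_real (x - 1) powr (\<mu> / 2) * complex_of_real (x + 1) powr (\<mu> / 2)"
    using x by (intro powr_times_real) auto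
  then show "(complex_of_real x - 1) powr (\<mu> / 2) * (complex_of_real x + 1) powr (\<mu> / 2) =
     complex_of_real (x\<^sup>2 - 1) powr (\<mu> / 2)"
    by (simp add: power2_eq_square algebra_simps)
qed

text \<open>
  The principal square root is the continuous branch that is positive for \<open>\<xi> > 0\<close>.
\<close>
lemma csqrt_sinh_branch:
  "continuous_on D1 (\<lambda>\<xi>. csqrt (of_real pi / (2 * sinh \<xi>)))"
  "x > 0 \<Longrightarrow> csqrt (of_real pi / (2 * sinh (of_real x))) = of_real (sqrt (pi / (2 * sinh x)))"
proof -
  have nz: "sinh \<xi> \<notin> \<real>\<^sub>\<le>\<^sub>0" if "\<xi> \<in> D1" for \<xi>
  proof
    have *: "Re \<xi> > 0" "\<bar>Im \<xi>\<bar> < pi" using that by (auto simp: D1_def)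
    have R: "Re (sinh \<xi>) = sinh (Re \<xi>) * cos (Im \<xi>)" and I: "Im (sinh \<xi>) = cosh (Re \<xi>) * sin (Im \<xi>)"
      by (simp_all add: sinh_field_def cosh_field_def Re_exp Im_exp field_simps)
    assume "sinh \<xi> \<in> \<real>\<^sub>\<le>\<^sub>0"
    then have "sin (Im \<xi>) = 0" and le: "sinh (Re \<xi>) * cos (Im \<xi>) \<le> 0"
      using R I by (auto simp: complex_nonpos_Reals_iff)
    then have "Im \<xi> = 0" using *(2) by (metis sin_eq_0_pi abs_less_iff minus_less_iff)
    then show False using le *(1) by (simp add: not_le)
  qed
  have "of_real pi / (2 * sinh \<xi>) \<notin> \<real>\<^sub>\<le>\<^sub>0" if "\<xi> \<in> D1" for \<xi>
  proof
    assume "of_real pi / (2 * sinh \<xi>) \<in> \<real>\<^sub>\<le>\<^sub>0"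
    then obtain r where r: "of_real pi / (2 * sinh \<xi>) = of_real r" "r \<le> 0"
      by (auto elim: nonpos_Reals_cases)
    have "sinh \<xi> \<noteq> 0" using nz[OF that] by auto
    then have "r \<noteq> 0" "sinh \<xi> = of_real (pi / (2 * r))" using r by (auto simp: field_simps)
    then show False using nz[OF that] r(2) by (simp only: nonpos_Reals_of_real_iff) (simp add: divide_nonneg_nonpos)
  qed
  moreover have "sinh \<xi> \<noteq> 0" if "\<xi> \<in> D1" for \<xi> using nz[OF that] by auto
  ultimately show "continuous_on D1 (\<lambda>\<xi>. csqrt (of_real pi / (2 * sinh \<xi>)))"
    by (intro continuous_on_compose2[OF continuous_on_csqrt] continuous_on_divide
        continuous_on_mult continuous_on_const continuous_on_sinh continuous_on_id) auto
  assume "x > 0"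
  have "of_real pi / (2 * sinh (of_real x)) = complex_of_real (pi / (2 * sinh x))"
    by (simp add: sinh_field_def exp_of_real flip: of_real_minus)
  then show "csqrt (of_real pi / (2 * sinh (of_real x))) = of_real (sqrt (pi / (2 * sinh x)))"
    using \<open>x > 0\<close> by (metis csqrt_of_real_nonneg Im_complex_of_real Re_complex_of_real
        divide_nonneg_pos mult_pos_pos pi_ge_zero sinh_real_pos_iff zero_less_numeral of_real_sqrt)
qed

end

theory Submission
  imports Defs
begin

text \<open>
  Put \<open>q = exp (- 2 \<xi>)\<close> and \<open>X = 1 / (1 - q)\<close>, so that \<open>|q| < 1\<close>, \<open>Re X > 0\<close> and
  \<open>exp \<xi> / sinh \<xi> = 2 X\<close>. Gauss' quadratic transformation continues the hypergeometric series in
  \<open>1 / cosh\<^sup>2 \<xi>\<close> to the slit plane and turns it into a series in \<open>q\<close>. That series is a multiple of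
  the integral of \<open>s\<^bsup>- 1/2 - \<mu>\<^esup> u\<^bsup>\<mu> - 1/2\<^esup> v\<^bsup>\<nu> - 1/2\<^esup> exp (- s - u - v) exp (- u s X / v)\<close> over the positive
  octant. Subtracting the Taylor polynomial of \<open>exp (- p)\<close> at \<open>p = u s X / v\<close> produces the
  asymptotic sum, and the remainder is the same integral with \<open>exp (- p)\<close> replaced by its Taylor
  remainder, which is at most \<open>|p|\<^sup>N / N!\<close> because \<open>Re p \<ge> 0\<close> and has sign \<open>(- 1)\<^sup>N\<close> when \<open>p > 0\<close>.
  The resulting bound is a product of three Gamma integrals. The identity is proved for real
  parameters with \<open>|\<mu>| < 1/2\<close>, where all integrands are nonnegative, and then extended
  analytically in \<open>\<mu>\<close>, \<open>\<nu>\<close> and \<open>q\<close> in turn; the Taylor remainder keeps the integral convergent for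
  \<open>|Re \<mu>| < N + 1/2\<close>.
\<close>

subsection \<open>Holomorphic functions defined by integrals and determined on the real line\<close>

text \<open>The unsubtracted integral converges absolutely only for |Re \<mu>| < 1/2: beyond that
  s^(-1/2-\<mu>) or u^(\<mu>-1/2) is not integrable at 0. The factor |p|^N in the bound for the
  Taylor remainder supplies N further powers of s and of u and costs N powers of v; this is where
  |Re \<mu>| < N + 1/2 and Re \<nu> > N - 1/2 come from. So the subtraction is done where all pieces
  converge, and only the subtracted identity is continued. Up to (-X)^k / k!, the k-th Taylor term
  integrates to Gamma(k+1/2-\<mu>) Gamma(k+1/2+\<mu>) Gamma(\<nu>-k+1/2). Reflection turns the first
  two factors into pi / cos(pi \<mu>) times the Pochhammer symbols of a_k(\<mu>), so the integral
  carries the weight cos(pi \<mu>) / pi. Taking absolute values replaces \<mu> by Re \<mu> in the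
  Gammas but not in the weight, hence the quotient of cosines in the bound and its limiting value.
  As \<open>hyp2F1_reg\<close> is a choice, a continuation must be exhibited before its values can
  be discussed.\<close>

lemma holomorphic_on_integral:
  fixes f :: "complex \<Rightarrow> 'a \<Rightarrow> complex"
  assumes S: "open S"
    and meas: "\<And>z. z \<in> S \<Longrightarrow> f z \<in> borel_measurable M"
    and hol: "\<And>x. x \<in> space M \<Longrightarrow> (\<lambda>z. f z x) holomorphic_on S"
    and dom: "\<And>z. z \<in> S \<Longrightarrow> \<exists>r>0. \<exists>g. cball z r \<subseteq> S \<and> integrable M g \<and>
                (\<forall>w\<in>cball z r. \<forall>x\<in>space M. norm (f w x) \<le> g x)"
  shows "(\<lambda>z. \<integral>x. f z x \<partial>M) holomorphic_on S"
proof -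
  have "\<exists>d. ((\<lambda>z. \<integral>x. f z x \<partial>M) has_field_derivative d) (at z0)" if z0: "z0 \<in> S" for z0
  proof -
    obtain r g where r: "r > 0" "cball z0 r \<subseteq> S" and g: "integrable M g"
      and bnd: "\<And>w x. w \<in> cball z0 r \<Longrightarrow> x \<in> space M \<Longrightarrow> norm (f w x) \<le> g x"
      using dom[OF z0] by blast
    \<comment> \<open>Halving the radius keeps every disc of radius r/2 about a point of
      \<open>B\<close> inside \<open>cball z0 r\<close>, where \<open>g\<close> dominates. Cauchy's
      inequality then bounds the derivative on \<open>B\<close>, hence the difference quotients, by
      the integrable g / (r/2).\<close>
    define B where "B = ball z0 (r / 2)"
    have BS: "B \<subseteq> S" "B \<subseteq> cball z0 r"
      using r by (auto simp: B_def subset_iff)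
    have int: "integrable M (f w)" if "w \<in> cball z0 r" for w
      using g meas[of w] that r(2) bnd[OF that]
      by (intro Bochner_Integration.integrable_bound[OF g]) (auto intro!: AE_I2 order_trans[OF _ abs_ge_self])
    define D where "D = (\<lambda>x. deriv (\<lambda>z. f z x) z0)"
    have lip: "norm (f w x - f z0 x) \<le> g x / (r / 2) * norm (w - z0)" if w: "w \<in> B" and x: "x \<in> space M" for w x
    proof (rule field_differentiable_bound[where S = B and f = "\<lambda>z. f z x"])
      show "convex B" "z0 \<in> B" "w \<in> B" using w r by (auto simp: B_def)
      fix y assume y: "y \<in> B"
      have sub: "cball y (r / 2) \<subseteq> cball z0 r"
        using y by (auto simp: B_def subset_iff dist_commute) (metric)
      show "((\<lambda>z. f z x) has_field_derivative deriv (\<lambda>z. f z x) y) (at y within B)"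
        using hol[OF x] y BS S by (meson has_field_derivative_at_within holomorphic_derivI subsetD)
      have "norm ((deriv ^^ 1) (\<lambda>z. f z x) y) \<le> fact 1 * g x / (r / 2) ^ 1"
      proof (rule Cauchy_inequality)
        show "(\<lambda>z. f z x) holomorphic_on ball y (r / 2)"
          using hol[OF x] sub r(2) by (meson ball_subset_cball holomorphic_on_subset order_trans)
        show "continuous_on (cball y (r / 2)) (\<lambda>z. f z x)"
          using hol[OF x] sub r(2) by (meson holomorphic_on_imp_continuous_on holomorphic_on_subset order_trans)
        fix w assume "norm (y - w) = r / 2"
        then show "norm (f w x) \<le> g x"
          using sub x by (intro bnd) (auto simp: subset_iff dist_norm)
      qed (use r in auto)
      then show "norm (deriv (\<lambda>z. f z x) y) \<le> g x / (r / 2)" by simp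
    qed
    have "((\<lambda>w. (\<integral>x. f w x \<partial>M) - (\<integral>x. f z0 x \<partial>M)) has_field_derivative (\<integral>x. D x \<partial>M)) (at z0 within B)
        \<longleftrightarrow> ((\<lambda>w. ((\<integral>x. f w x \<partial>M) - (\<integral>x. f z0 x \<partial>M)) / (w - z0)) \<longlongrightarrow> (\<integral>x. D x \<partial>M)) (at z0 within B)"
      by (simp add: has_field_derivative_iff)
    also have \<dots> unfolding tendsto_at_iff_sequentially
    proof (intro allI impI)
      fix X :: "nat \<Rightarrow> complex" assume X: "\<forall>i. X i \<in> B - {z0}" "X \<longlonglongrightarrow> z0"
      have "(\<lambda>i. \<integral>x. (f (X i) x - f z0 x) / (X i - z0) \<partial>M) \<longlonglongrightarrow> (\<integral>x. D x \<partial>M)"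
      proof (rule integral_dominated_convergence[where w = "\<lambda>x. g x / (r / 2)"])
        have lim: "(\<lambda>i. (f (X i) x - f z0 x) / (X i - z0)) \<longlonglongrightarrow> D x" if x: "x \<in> space M" for x
        proof -
          have "((\<lambda>z. f z x) has_field_derivative D x) (at z0)"
            unfolding D_def using hol[OF x] S z0 by (rule holomorphic_derivI)
          then have "((\<lambda>w. (f w x - f z0 x) / (w - z0)) \<longlongrightarrow> D x) (at z0)"
            by (simp add: has_field_derivative_iff)
          then show ?thesis
            using X unfolding tendsto_at_iff_sequentially by (auto simp: o_def)
        qed
        then show "AE x in M. (\<lambda>i. (f (X i) x - f z0 x) / (X i - z0)) \<longlonglongrightarrow> D x" by simp
        show m: "(\<lambda>x. (f (X i) x - f z0 x) / (X i - z0)) \<in> borel_measurable M" for i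
          using meas[of "X i"] meas[OF z0] X(1) BS by (auto intro!: borel_measurable_divide borel_measurable_diff)
        show "D \<in> borel_measurable M"
          by (rule borel_measurable_LIMSEQ_metric[OF m lim])
        show "integrable M (\<lambda>x. g x / (r / 2))" using g by (rule integrable_divide)
        show "AE x in M. norm ((f (X i) x - f z0 x) / (X i - z0)) \<le> g x / (r / 2)" for i
        proof (rule AE_I2)
          fix x assume x: "x \<in> space M"
          have "X i \<in> B" "X i \<noteq> z0" using X(1) by auto
          then show "norm ((f (X i) x - f z0 x) / (X i - z0)) \<le> g x / (r / 2)"
            using lip[OF _ x, of "X i"] by (simp add: norm_divide divide_le_eq)
        qed
      qed
      moreover have "(\<integral>x. (f (X i) x - f z0 x) / (X i - z0) \<partial>M) =
          ((\<integral>x. f (X i) x \<partial>M) - (\<integral>x. f z0 x \<partial>M)) / (X i - z0)" for i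
        using X(1) BS r int[of "X i"] int[of z0]
        by (subst Bochner_Integration.integral_diff[symmetric]) (auto simp: subset_iff)
      ultimately show "((\<lambda>w. ((\<integral>x. f w x \<partial>M) - (\<integral>x. f z0 x \<partial>M)) / (w - z0)) \<circ> X) \<longlonglongrightarrow> (\<integral>x. D x \<partial>M)"
        by (simp only: o_def)
    qed
    finally have "((\<lambda>w. (\<integral>x. f w x \<partial>M) - (\<integral>x. f z0 x \<partial>M)) has_field_derivative (\<integral>x. D x \<partial>M)) (at z0)"
      using r by (subst (asm) at_within_open) (auto simp: B_def)
    from DERIV_add[OF this DERIV_const[of "\<integral>x. f z0 x \<partial>M"]] show ?thesis by auto
  qed
  then show ?thesis by (simp add: holomorphic_on_open[OF S])
qed

text \<open>The midpoint of the interval is the accumulation point that the identity theorem asks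
  for. Every continuation below, in \<mu>, \<nu>, q, w or \<xi>, starts from a real
  interval.\<close>

lemma holomorphic_eq_from_reals:
  assumes "f holomorphic_on S" "g holomorphic_on S" and S: "open S" "connected S"
    and ab: "a < b" and eq: "\<And>x :: real. a < x \<Longrightarrow> x < b \<Longrightarrow> of_real x \<in> S \<and> f (of_real x) = g (of_real x)"
    and z: "z \<in> S"
  shows "f z = (g z :: complex)"
proof -
  let ?U = "complex_of_real ` {a<..<b}"
  define c where "c = (a + b) / 2"
  have c: "a < c" "c < b" using ab by (auto simp: c_def)
  have "of_real c islimpt ?U"
    unfolding islimpt_approachable
  proof (intro allI impI)
    fix e :: real assume e: "e > 0"
    define x where "x = c + min (e / 2) ((b - c) / 2)"
    have x: "x > c" "x \<le> c + (b - c) / 2" "x - c < e"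
      using e c by (auto simp: x_def min_def)
    then have "a < x" "x < b" "x \<noteq> c"
      using c by (auto simp: field_simps)
    moreover have "dist (complex_of_real x) (of_real c) < e"
      using x by (simp add: dist_norm flip: of_real_diff)
    ultimately have "a < x" "x < b" "x \<noteq> c" "dist (complex_of_real x) (of_real c) < e"
      by blast+
    then show "\<exists>x'\<in>?U. x' \<noteq> of_real c \<and> dist x' (of_real c) < e"
      by (intro bexI[of _ "of_real x"]) auto
  qed
  have "f z - g z = 0"
  proof (rule analytic_continuation[where f = "\<lambda>z. f z - g z" and U = ?U and \<xi> = "of_real c"])
    show "(\<lambda>z. f z - g z) holomorphic_on S" by (intro holomorphic_intros assms)
    show "?U \<subseteq> S" using eq by auto
    show "of_real c \<in> S" using eq c by blast
    show "of_real c islimpt ?U" by fact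
  qed (use eq S z in auto)
  then show ?thesis by simp
qed

subsection \<open>Taylor remainders of the exponential function\<close>

text \<open>Polymorphic because the integrand needs complex arguments, while the sign of the
  remainder is an order statement about real ones.\<close>

definition exp_rem :: "nat \<Rightarrow> 'a :: {real_normed_field,banach} \<Rightarrow> 'a" where
  "exp_rem N p = exp (- p) - (\<Sum>n<N. (- p) ^ n / fact n)"

lemma exp_rem_of_real: "exp_rem N (of_real p) = (of_real (exp_rem N p) :: complex)"
  by (simp add: exp_rem_def exp_of_real flip: of_real_minus)

lemma exp_rem_Suc_0 [simp]: "exp_rem (Suc N) 0 = 0"
  by (simp add: exp_rem_def sum.lessThan_Suc_shift del: sum.lessThan_Suc)

text \<open>Differentiation lowers the order by one, so both the bound and the sign follow by
  induction on the order.\<close>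

lemma DERIV_exp_rem_Suc: "(exp_rem (Suc N) has_field_derivative - exp_rem N p) (at p)"
proof -
  have "((\<lambda>p. (- p) ^ n / fact n) has_field_derivative - (of_nat n * (- p) ^ (n - 1) / fact n)) (at p)" for n
    by (rule derivative_eq_intros refl | simp)+
  then have "((\<lambda>p. exp (- p) - (\<Sum>n<Suc N. (- p) ^ n / fact n)) has_field_derivative
     - exp (- p) - (\<Sum>n<Suc N. - (of_nat n * (- p) ^ (n - 1) / fact n))) (at p)"
    by (intro DERIV_diff DERIV_sum) (auto intro!: derivative_eq_intros)
  also have "(\<Sum>n<Suc N. - (of_nat n * (- p) ^ (n - 1) / fact n)) = - (\<Sum>n<N. (- p) ^ n / fact n)"
    by (simp add: sum.lessThan_Suc_shift sum_negf del: sum.lessThan_Suc of_nat_Suc)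
  finally show ?thesis by (simp add: exp_rem_def[abs_def])
qed

text \<open>The remainder is the integral of its derivative along the segment from 0 to
  \<open>p\<close>. That segment stays in Re \<ge> 0, so the induction hypothesis applies on it; the
  base case is |exp(-p)| \<le> 1.\<close>

lemma norm_exp_rem_le:
  fixes p :: complex
  assumes "Re p \<ge> 0"
  shows "norm (exp_rem N p) \<le> norm p ^ N / fact N"
  using assms
proof (induction N arbitrary: p)
  case 0
  then show ?case by (simp add: exp_rem_def)
next
  case (Suc N)
  have der: "((\<lambda>t. exp_rem (Suc N) (of_real t * p)) has_vector_derivative - exp_rem N (of_real t * p) * p) (at t within {0..1})" for t
  proof -
    have "((\<lambda>t. exp_rem (Suc N) (of_real t * p)) has_vector_derivative (p * - exp_rem N (of_real t * p))) (at t within {0..1})"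
      unfolding o_def[symmetric, of "exp_rem (Suc N)" "\<lambda>t. of_real t * p"]
      by (rule field_vector_diff_chain_within)
         (auto intro!: derivative_eq_intros has_field_derivative_at_within DERIV_exp_rem_Suc
            simp: has_vector_derivative_def scaleR_conv_of_real)
    then show ?thesis by (simp add: mult.commute)
  qed
  have int: "((\<lambda>t. - exp_rem N (of_real t * p) * p) has_integral
      exp_rem (Suc N) (of_real 1 * p) - exp_rem (Suc N) (of_real 0 * p)) {0..1}"
    by (rule fundamental_theorem_of_calculus) (use der in auto)
  have "((\<lambda>t. norm p ^ Suc N / fact (Suc N) * t ^ Suc N) has_real_derivative norm p ^ Suc N / fact N * t ^ N)
      (at t within {0..1})" for t :: real
    by (rule derivative_eq_intros refl | simp del: of_nat_Suc power_Suc)+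
  then have "((\<lambda>t. norm p ^ Suc N / fact N * t ^ N) has_integral
      norm p ^ Suc N / fact (Suc N) * 1 ^ Suc N - norm p ^ Suc N / fact (Suc N) * 0 ^ Suc N) {0..1::real}"
    by (intro fundamental_theorem_of_calculus)
       (simp_all only: has_real_derivative_iff_has_vector_derivative zero_le_one)
  then have int2: "((\<lambda>t. norm p ^ Suc N / fact N * t ^ N) has_integral norm p ^ Suc N / fact (Suc N)) {0..1::real}"
    by simp
  have "norm (integral {0..1} (\<lambda>t. - exp_rem N (of_real t * p) * p)) \<le>
     integral {0..1} (\<lambda>t. norm p ^ Suc N / fact N * t ^ N)"
  proof (rule integral_norm_bound_integral)
    fix t :: real assume t: "t \<in> {0..1}"
    have "norm (exp_rem N (of_real t * p)) \<le> norm (of_real t * p) ^ N / fact N"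
      using Suc.prems t by (intro Suc.IH) simp
    then show "norm (- exp_rem N (of_real t * p) * p) \<le> norm p ^ Suc N / fact N * t ^ N"
      using t mult_right_mono[of _ _ "norm p"] by (fastforce simp: norm_mult power_mult_distrib mult_ac)
  qed (use int int2 in blast)+
  then show ?case
    unfolding integral_unique[OF int] integral_unique[OF int2] by simp
qed

text \<open>For positive order the signed remainder vanishes at 0, and its derivative is the signed
  remainder of the previous order, positive by induction.\<close>

lemma exp_rem_sign:
  fixes p :: real
  assumes "p > 0"
  shows "(- 1) ^ N * exp_rem N p > 0"
  using assms
proof (induction N arbitrary: p)
  case 0
  then show ?case by (simp add: exp_rem_def)
next
  case (Suc N)
  have "(- 1) ^ Suc N * exp_rem (Suc N) 0 < (- 1) ^ Suc N * exp_rem (Suc N) p"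
  proof (rule DERIV_pos_imp_increasing_open[OF \<open>p > 0\<close>])
    fix x :: real assume "0 < x" "x < p"
    have "((\<lambda>x. (- 1) ^ Suc N * exp_rem (Suc N) x) has_real_derivative (- 1) ^ N * exp_rem N x) (at x)"
      by (rule derivative_eq_intros DERIV_exp_rem_Suc refl | simp)+
    then show "\<exists>y. ((\<lambda>x. (- 1) ^ Suc N * exp_rem (Suc N) x) has_real_derivative y) (at x) \<and> y > 0"
      using Suc.IH[OF \<open>0 < x\<close>] by blast
  next
    show "continuous_on {0..p} (\<lambda>x. (- 1) ^ Suc N * exp_rem (Suc N) x)"
      unfolding exp_rem_def by (intro continuous_intros) auto
  qed
  then show ?case by simp
qed

subsection \<open>Gamma and Beta integrals over the positive octant\<close>

text \<open>Restricting the space, rather than multiplying by an indicator, confines all pointwise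
  bounds to arguments where \<open>ln\<close> and \<open>powr\<close> have their usual
  meaning.\<close>

definition pos_lborel :: "real measure" where
  "pos_lborel = restrict_space lborel {0<..}"

text \<open>Coordinates are ordered (s, v, u): u is innermost because it is the variable that gets
  substituted.\<close>

abbreviation octant :: "(real \<times> real \<times> real) measure" where
  "octant \<equiv> pos_lborel \<Otimes>\<^sub>M (pos_lborel \<Otimes>\<^sub>M pos_lborel)"

lemma space_pos_lborel [simp]: "space pos_lborel = {0<..}"
  by (simp add: pos_lborel_def space_restrict_space)

lemma space_octant: "space octant = {0<..} \<times> {0<..} \<times> {0<..}"
  by (simp add: space_pair_measure)

lemma sigma_finite_pos_lborel: "sigma_finite_measure pos_lborel"
  unfolding pos_lborel_def by (intro sigma_finite_measure_restrict_space lborel.sigma_finite_measure_axioms) simp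

interpretation pos_lborel: sigma_finite_measure pos_lborel
  by (rule sigma_finite_pos_lborel)

interpretation pos_lborel_pair: pair_sigma_finite pos_lborel pos_lborel ..

lemma ident_measurable_pos_lborel: "(\<lambda>x. x) \<in> pos_lborel \<rightarrow>\<^sub>M borel"
  unfolding pos_lborel_def by (rule measurable_restrict_space1) simp

lemma measurable_pos_lborel: "f \<in> borel \<rightarrow>\<^sub>M N \<Longrightarrow> f \<in> pos_lborel \<rightarrow>\<^sub>M N"
  by (rule measurable_compose[OF ident_measurable_pos_lborel])

lemma measurable_pos_lborel2: "f \<in> borel \<Otimes>\<^sub>M borel \<rightarrow>\<^sub>M N \<Longrightarrow> f \<in> pos_lborel \<Otimes>\<^sub>M pos_lborel \<rightarrow>\<^sub>M N"
proof -
  have "(\<lambda>x. (fst x, snd x)) \<in> pos_lborel \<Otimes>\<^sub>M pos_lborel \<rightarrow>\<^sub>M borel \<Otimes>\<^sub>M borel"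
    by (intro measurable_Pair measurable_compose[OF measurable_fst ident_measurable_pos_lborel]
          measurable_compose[OF measurable_snd ident_measurable_pos_lborel])
  then show "f \<in> borel \<Otimes>\<^sub>M borel \<rightarrow>\<^sub>M N \<Longrightarrow> ?thesis"
    using measurable_compose by fastforce
qed

lemma measurable_octant: "f \<in> borel \<Otimes>\<^sub>M (borel \<Otimes>\<^sub>M borel) \<rightarrow>\<^sub>M N \<Longrightarrow> f \<in> octant \<rightarrow>\<^sub>M N"
proof -
  have "(\<lambda>x. (fst x, snd x)) \<in> octant \<rightarrow>\<^sub>M borel \<Otimes>\<^sub>M (borel \<Otimes>\<^sub>M borel)"
    by (intro measurable_Pair measurable_compose[OF measurable_fst ident_measurable_pos_lborel]
          measurable_compose[OF measurable_snd measurable_pos_lborel2]) simp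
  then show "f \<in> borel \<Otimes>\<^sub>M (borel \<Otimes>\<^sub>M borel) \<rightarrow>\<^sub>M N \<Longrightarrow> ?thesis"
    using measurable_compose by fastforce
qed

lemma nn_integral_Gamma:
  fixes p k :: real
  assumes "p > 0" "k > 0"
  shows "(\<integral>\<^sup>+x. ennreal (x powr (p - 1) * exp (- (k * x))) \<partial>pos_lborel) = ennreal (Gamma p * k powr (- p))"
proof -
  define I where "I = (\<integral>\<^sup>+x. ennreal (x powr (p - 1) * exp (- (k * x))) \<partial>pos_lborel)"
  have "ennreal (Gamma p) = (\<integral>\<^sup>+t. ennreal (indicator {0..} t * t powr (p - 1) / exp t) \<partial>lborel)"
    by (rule Gamma_conv_nn_integral_real) fact
  also have "\<dots> = \<bar>k\<bar> * (\<integral>\<^sup>+x. ennreal (indicator {0..} (0 + k * x) * (0 + k * x) powr (p - 1) / exp (0 + k * x)) \<partial>lborel)"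
    using assms by (intro nn_integral_real_affine) auto
  also have "(\<integral>\<^sup>+x. ennreal (indicator {0..} (0 + k * x) * (0 + k * x) powr (p - 1) / exp (0 + k * x)) \<partial>lborel) =
     (\<integral>\<^sup>+x. ennreal (k powr (p - 1)) * (ennreal (x powr (p - 1) * exp (- (k * x))) * indicator {0<..} x) \<partial>lborel)"
  proof (rule nn_integral_cong)
    fix x :: real
    show "ennreal (indicator {0..} (0 + k * x) * (0 + k * x) powr (p - 1) / exp (0 + k * x)) =
      ennreal (k powr (p - 1)) * (ennreal (x powr (p - 1) * exp (- (k * x))) * indicator {0<..} x)"
      using assms
      by (cases x "0::real" rule: linorder_cases)
         (auto simp: indicator_def powr_mult exp_minus field_simps zero_le_mult_iff ennreal_mult'[symmetric])
  qed
  also have "\<dots> = ennreal (k powr (p - 1)) * I"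
    unfolding I_def pos_lborel_def
    by (subst nn_integral_restrict_space) (simp_all add: nn_integral_cmult)
  also have "\<bar>k\<bar> * (ennreal (k powr (p - 1)) * I) = ennreal (k powr p) * I"
    using assms by (simp add: ennreal_mult' [symmetric] mult.assoc[symmetric] powr_diff)
  finally have eq: "ennreal (Gamma p) = ennreal (k powr p) * I" .
  have "ennreal (Gamma p * k powr (- p)) = ennreal (k powr (- p)) * ennreal (Gamma p)"
    by (subst mult.commute, subst ennreal_mult') simp_all
  also have "\<dots> = ennreal (k powr (- p) * k powr p) * I"
    by (simp add: eq ennreal_mult' mult.assoc)
  also have "k powr (- p) * k powr p = 1" using assms by (simp flip: powr_add)
  finally show ?thesis by (simp add: I_def)
qed

text \<open>The power of 1 + r is written as a Gamma integral in k. After Tonelli the r-integral is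
  again a Gamma integral, and so is the k-integral that remains.\<close>

lemma nn_integral_Beta:
  fixes x y :: real
  assumes "x > 0" "y > 0"
  shows "(\<integral>\<^sup>+r. ennreal (r powr (x - 1) * (1 + r) powr (- (x + y))) \<partial>pos_lborel) = ennreal (Gamma x * Gamma y / Gamma (x + y))"
proof -
  have G: "Gamma (x + y) > 0" using assms by (simp add: Gamma_real_pos)
  have "ennreal (Gamma (x + y)) * (\<integral>\<^sup>+r. ennreal (r powr (x - 1) * (1 + r) powr (- (x + y))) \<partial>pos_lborel) =
     (\<integral>\<^sup>+r. ennreal (r powr (x - 1)) * ennreal (Gamma (x + y) * (1 + r) powr (- (x + y))) \<partial>pos_lborel)"
    using G by (subst nn_integral_cmult[symmetric])
      (auto intro!: nn_integral_cong measurable_pos_lborel simp: ennreal_mult'[symmetric] mult_ac)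
  also have "\<dots> = (\<integral>\<^sup>+r. \<integral>\<^sup>+k. ennreal (r powr (x - 1)) * ennreal (k powr (x + y - 1) * exp (- ((1 + r) * k))) \<partial>pos_lborel \<partial>pos_lborel)"
    using assms by (intro nn_integral_cong)
      (simp add: nn_integral_cmult nn_integral_Gamma measurable_pos_lborel)
  also have "\<dots> = (\<integral>\<^sup>+k. \<integral>\<^sup>+r. ennreal (r powr (x - 1)) * ennreal (k powr (x + y - 1) * exp (- ((1 + r) * k))) \<partial>pos_lborel \<partial>pos_lborel)"
    by (rule pos_lborel_pair.Fubini') (intro measurable_pos_lborel2, measurable)
  also have "\<dots> = (\<integral>\<^sup>+k. ennreal (Gamma x) * ennreal (k powr (y - 1) * exp (- (1 * k))) \<partial>pos_lborel)"
  proof (rule nn_integral_cong)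
    fix k assume "k \<in> space pos_lborel"
    then have k: "k > 0" by simp
    have "(\<integral>\<^sup>+r. ennreal (r powr (x - 1)) * ennreal (k powr (x + y - 1) * exp (- ((1 + r) * k))) \<partial>pos_lborel) =
       (\<integral>\<^sup>+r. ennreal (k powr (x + y - 1) * exp (- k)) * ennreal (r powr (x - 1) * exp (- (k * r))) \<partial>pos_lborel)"
      by (intro nn_integral_cong) (simp add: ennreal_mult'[symmetric] algebra_simps exp_diff exp_minus exp_add divide_inverse)
    also have "\<dots> = ennreal (k powr (x + y - 1) * exp (- k)) * ennreal (Gamma x * k powr (- x))"
      using assms k by (simp add: nn_integral_cmult nn_integral_Gamma measurable_pos_lborel)
    also have "\<dots> = ennreal (Gamma x) * ennreal (k powr (y - 1) * exp (- (1 * k)))"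
      using assms k Gamma_real_pos[of x]
      by (simp add: ennreal_mult'[symmetric] powr_minus powr_diff powr_add field_simps)
    finally show "(\<integral>\<^sup>+r. ennreal (r powr (x - 1)) * ennreal (k powr (x + y - 1) * exp (- ((1 + r) * k))) \<partial>pos_lborel) =
       ennreal (Gamma x) * ennreal (k powr (y - 1) * exp (- (1 * k)))" .
  qed
  also have "\<dots> = ennreal (Gamma x) * ennreal (Gamma y)"
    using nn_integral_Gamma[of y 1] assms by (simp add: nn_integral_cmult measurable_pos_lborel)
  finally have eq: "ennreal (Gamma (x + y)) * (\<integral>\<^sup>+r. ennreal (r powr (x - 1) * (1 + r) powr (- (x + y))) \<partial>pos_lborel) =
    ennreal (Gamma x) * ennreal (Gamma y)" .
  define I where "I = (\<integral>\<^sup>+r. ennreal (r powr (x - 1) * (1 + r) powr (- (x + y))) \<partial>pos_lborel)"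
  have "ennreal (1 / Gamma (x + y)) * (ennreal (Gamma (x + y)) * I) = I"
    using G by (simp add: mult.assoc[symmetric] ennreal_mult'[symmetric])
  moreover have "ennreal (1 / Gamma (x + y)) * (ennreal (Gamma x) * ennreal (Gamma y)) = ennreal (Gamma x * Gamma y / Gamma (x + y))"
    using G assms Gamma_real_pos[of x] Gamma_real_pos[of y] by (simp add: ennreal_mult'[symmetric])
  ultimately show ?thesis using eq by (simp add: I_def)
qed

lemma nn_integral_octant:
  assumes f: "f \<in> borel_measurable octant"
  shows "integral\<^sup>N octant f = (\<integral>\<^sup>+s. \<integral>\<^sup>+v. \<integral>\<^sup>+u. f (s, v, u) \<partial>pos_lborel \<partial>pos_lborel \<partial>pos_lborel)"
proof -
  have "integral\<^sup>N octant f = (\<integral>\<^sup>+s. \<integral>\<^sup>+x. f (s, x) \<partial>(pos_lborel \<Otimes>\<^sub>M pos_lborel) \<partial>pos_lborel)"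
    by (rule pos_lborel_pair.P.nn_integral_fst[OF f, symmetric])
  also have "\<dots> = (\<integral>\<^sup>+s. \<integral>\<^sup>+v. \<integral>\<^sup>+u. f (s, v, u) \<partial>pos_lborel \<partial>pos_lborel \<partial>pos_lborel)"
    by (intro nn_integral_cong pos_lborel.nn_integral_fst[symmetric]) (auto simp: measurable_Pair2[OF f])
  finally show ?thesis .
qed

lemma nn_integral_octant_Gamma:
  fixes a b c :: real
  assumes "a > 0" "b > 0" "c > 0"
  shows "(\<integral>\<^sup>+(s, v, u). ennreal (s powr (a - 1) * v powr (c - 1) * u powr (b - 1) * exp (- s - v - u)) \<partial>octant) =
    ennreal (Gamma a * Gamma b * Gamma c)"
proof -
  define g where "g = (\<lambda>p x :: real. ennreal (x powr (p - 1) * exp (- (1 * x))))"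
  have [measurable]: "g p \<in> borel_measurable borel" for p unfolding g_def by measurable
  have g: "p > 0 \<Longrightarrow> integral\<^sup>N pos_lborel (g p) = ennreal (Gamma p)" for p
    using nn_integral_Gamma[of p 1] by (simp add: g_def)
  have "(\<integral>\<^sup>+(s, v, u). ennreal (s powr (a - 1) * v powr (c - 1) * u powr (b - 1) * exp (- s - v - u)) \<partial>octant) =
    (\<integral>\<^sup>+(s, v, u). g a s * (g c v * g b u) \<partial>octant)"
    by (intro nn_integral_cong) (auto simp: g_def ennreal_mult'[symmetric] exp_diff exp_minus exp_add field_simps)
  also have "\<dots> = (\<integral>\<^sup>+s. \<integral>\<^sup>+v. \<integral>\<^sup>+u. g a s * (g c v * g b u) \<partial>pos_lborel \<partial>pos_lborel \<partial>pos_lborel)"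
    by (subst nn_integral_octant) (auto intro!: measurable_octant)
  also have "\<dots> = ennreal (Gamma a) * (ennreal (Gamma c) * ennreal (Gamma b))"
    using assms by (simp add: nn_integral_cmult nn_integral_multc measurable_pos_lborel g)
  also have "\<dots> = ennreal (Gamma a * Gamma b * Gamma c)"
    using Gamma_real_pos[of a] Gamma_real_pos[of b] Gamma_real_pos[of c] assms
    by (simp add: ennreal_mult'[symmetric] mult_ac)
  finally show ?thesis .
qed

lemma suminf_ennreal_exp:
  assumes "x \<ge> 0" "y \<ge> 0"
  shows "(\<Sum>n. ennreal (x ^ n / fact n * y)) = ennreal (exp x * y)"
proof (rule suminf_ennreal_eq)
  show "0 \<le> x ^ n / fact n * y" for n using assms by simp
  show "(\<lambda>n. x ^ n / fact n * y) sums (exp x * y)"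
    using sums_mult2[OF exp_converges[of x], of y] by (simp add: field_simps)
qed

text \<open>
  With \<open>u = (1 - q) v r\<close> the exponent becomes \<open>- (1 + r) (s + v) + q r v\<close>; expanding \<open>exp (q r v)\<close>
  leaves only Gamma and Beta integrals.
\<close>
lemma nn_integral_octant_hypergeometric:
  fixes a b c q :: real
  assumes a: "a > 0" and b: "b > 0" and ca: "c > a" and cb: "c > b" and q: "0 < q" "q < 1"
  shows "(\<integral>\<^sup>+(s, v, u). ennreal (s powr (a - 1) * v powr (c - a - b - 1) * u powr (b - 1) * exp (- s - v - u)
             * exp (- (u * s / v * (1 / (1 - q))))) \<partial>octant) =
    (\<Sum>n. ennreal ((1 - q) powr b * q ^ n / fact n * Gamma a * Gamma (c - a + n) *
        (Gamma (b + n) * Gamma (c - b) / Gamma (c + n))))"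
    (is "(\<integral>\<^sup>+(s, v, u). ?F s v u \<partial>octant) = _")
proof -
  \<comment> \<open>Integrand after u = (1-q) v r. Here u^(b-1) du contributes ((1-q) v)^b r^(b-1)
    dr, which raises the exponent of v from c-a-b-1 to c-a-1.\<close>
  define G where "G = (\<lambda>s v r :: real. ennreal ((1 - q) powr b * s powr (a - 1) * v powr (c - a - 1) * r powr (b - 1) *
     exp (- s - v - r * s - r * v + q * r * v)))"
  have G_measurable: "(\<lambda>(s, v, r). G s v r) \<in> borel_measurable (borel \<Otimes>\<^sub>M (borel \<Otimes>\<^sub>M borel))"
    unfolding G_def by measurable
  define K where "K = (\<lambda>n :: nat. (1 - q) powr b * q ^ n / fact n * Gamma a * Gamma (c - a + n))"
  have K_nonneg: "K n \<ge> 0" for n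
    using a ca q Gamma_real_pos[of a] Gamma_real_pos[of "c - a + n"] by (auto simp: K_def)
  \<comment> \<open>The substitution is verified by evaluation: for fixed s and v both inner
    integrals are Gamma integrals, equal to the same multiple of Gamma(b) k^(-b) with k = (1-q) v +
    s.\<close>
  have subst: "(\<integral>\<^sup>+u. ?F s v u \<partial>pos_lborel) = (\<integral>\<^sup>+r. G s v r \<partial>pos_lborel)" if s: "s > 0" and v: "v > 0" for s v
  proof -
    define k where "k = (1 - q) * v + s"
    have k: "k > 0" and k': "1 + s / (v * (1 - q)) = k / (v * (1 - q))"
      using s v q by (simp_all add: k_def add_pos_pos) (simp add: field_simps)
    have e: "exp (- s - v - u) * exp (- (u * s / v * (1 / (1 - q)))) = exp (- s - v) * exp (- ((1 + s / (v * (1 - q))) * u))" for u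
      by (simp add: ring_distribs mult.commute flip: exp_add)
    have "(\<integral>\<^sup>+u. ?F s v u \<partial>pos_lborel) = (\<integral>\<^sup>+u. ennreal (s powr (a - 1) * v powr (c - a - b - 1) * exp (- s - v)) *
        ennreal (u powr (b - 1) * exp (- ((k / (v * (1 - q))) * u))) \<partial>pos_lborel)"
      unfolding k'[symmetric]
      by (intro nn_integral_cong) (simp only: mult.assoc e, simp add: ennreal_mult'[symmetric] mult_ac)
    also have "\<dots> = ennreal (s powr (a - 1) * v powr (c - a - b - 1) * exp (- s - v)) *
        ennreal (Gamma b * (k / (v * (1 - q))) powr (- b))"
      using b k v q by (subst nn_integral_cmult, (intro measurable_pos_lborel, measurable)[], subst nn_integral_Gamma) simp_all
    also have "\<dots> = ennreal ((1 - q) powr b * s powr (a - 1) * v powr (c - a - 1) * exp (- s - v)) *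
        ennreal (Gamma b * k powr (- b))"
      using b k v q s Gamma_real_pos[of b]
      by (simp add: ennreal_mult'[symmetric] powr_divide powr_mult powr_minus powr_diff) (simp add: field_simps)
    also have "\<dots> = (\<integral>\<^sup>+r. ennreal ((1 - q) powr b * s powr (a - 1) * v powr (c - a - 1) * exp (- s - v)) *
        ennreal (r powr (b - 1) * exp (- (k * r))) \<partial>pos_lborel)"
      using b k by (simp add: nn_integral_cmult nn_integral_Gamma measurable_pos_lborel)
    also have "\<dots> = (\<integral>\<^sup>+r. G s v r \<partial>pos_lborel)"
      unfolding G_def k_def using q
      by (intro nn_integral_cong)
         (simp add: ennreal_mult'[symmetric] exp_add exp_minus exp_diff algebra_simps divide_inverse)
    finally show ?thesis .
  qed
  \<comment> \<open>For fixed r the exponent is -(1+r) s - (1+r) v + q r v, so the s- and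
    v-integrals separate. With q > 0 all terms of the expanded exponential are nonnegative, and sum
    and integral commute freely.\<close>
  have inner: "(\<integral>\<^sup>+s. \<integral>\<^sup>+v. G s v r \<partial>pos_lborel \<partial>pos_lborel) =
      (\<Sum>n. ennreal (K n * (r powr (b + n - 1) * (1 + r) powr (- ((b + n) + (c - b))))))" if r: "r > 0" for r
  proof -
    define g where "g = (\<lambda>s. (1 - q) powr b * r powr (b - 1) * (s powr (a - 1) * exp (- ((1 + r) * s))))"
    have g: "g s \<ge> 0" for s unfolding g_def using q by simp
    have g_measurable: "(\<lambda>s. ennreal (g s)) \<in> borel_measurable pos_lborel"
      unfolding g_def by (intro measurable_pos_lborel) measurable
    define h where "h = (\<lambda>n :: nat. (q * r) ^ n / fact n * (Gamma (c - a + n) * (1 + r) powr (- (c - a + n))))"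
    have h: "h n \<ge> 0" for n
      unfolding h_def using q r ca Gamma_real_pos[of "c - a + n"] by simp
    have "(\<integral>\<^sup>+v. G s v r \<partial>pos_lborel) = ennreal (g s) * (\<Sum>n. ennreal (h n))" if s: "s > 0" for s
    proof -
      have "(\<integral>\<^sup>+v. G s v r \<partial>pos_lborel) =
        (\<integral>\<^sup>+v. ennreal (g s) * (\<Sum>n. ennreal ((q * r * v) ^ n / fact n * (v powr (c - a - 1) * exp (- ((1 + r) * v))))) \<partial>pos_lborel)"
        using q r g
        by (intro nn_integral_cong, subst suminf_ennreal_exp)
           (auto simp: G_def g_def ennreal_mult'[symmetric] exp_add exp_minus exp_diff algebra_simps divide_inverse)
      also have "\<dots> = (\<integral>\<^sup>+v. ennreal (g s) * (\<Sum>n. ennreal ((q * r) ^ n / fact n) *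
          ennreal (v powr (c - a + n - 1) * exp (- ((1 + r) * v)))) \<partial>pos_lborel)"
        using q r
        by (intro nn_integral_cong arg_cong[where f = "\<lambda>x. _ * x"] suminf_cong)
           (auto simp: ennreal_mult'[symmetric] power_mult_distrib powr_diff powr_add powr_realpow)
      also have "\<dots> = ennreal (g s) * (\<Sum>n. ennreal ((q * r) ^ n / fact n) *
          ennreal (Gamma (c - a + n) * (1 + r) powr (- (c - a + n))))"
        using ca r
        by (simp add: nn_integral_cmult nn_integral_suminf nn_integral_Gamma measurable_pos_lborel add_pos_nonneg)
      also have "\<dots> = ennreal (g s) * (\<Sum>n. ennreal (h n))"
        using q r by (simp add: h_def ennreal_mult'[symmetric])
      finally show ?thesis .
    qed
    then have "(\<integral>\<^sup>+s. \<integral>\<^sup>+v. G s v r \<partial>pos_lborel \<partial>pos_lborel) = (\<integral>\<^sup>+s. ennreal (g s) * (\<Sum>n. ennreal (h n)) \<partial>pos_lborel)"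
      by (intro nn_integral_cong) simp
    also have "\<dots> = (\<integral>\<^sup>+s. ennreal (g s) \<partial>pos_lborel) * (\<Sum>n. ennreal (h n))"
      using g_measurable by (rule nn_integral_multc)
    also have "(\<integral>\<^sup>+s. ennreal (g s) \<partial>pos_lborel) = ennreal ((1 - q) powr b * r powr (b - 1)) * ennreal (Gamma a * (1 + r) powr (- a))"
      unfolding g_def using a r q
      by (subst ennreal_mult') (simp_all add: nn_integral_cmult nn_integral_Gamma measurable_pos_lborel)
    also have "\<dots> = ennreal ((1 - q) powr b * r powr (b - 1) * (Gamma a * (1 + r) powr (- a)))"
      using q by (simp add: ennreal_mult')
    also have "\<dots> * (\<Sum>n. ennreal (h n)) = (\<Sum>n. ennreal ((1 - q) powr b * r powr (b - 1) * (Gamma a * (1 + r) powr (- a)) * h n))"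
      using q a Gamma_real_pos[of a] by (subst ennreal_suminf_cmult[symmetric]) (simp add: ennreal_mult')
    also have "\<dots> = (\<Sum>n. ennreal (K n * (r powr (b + n - 1) * (1 + r) powr (- ((b + n) + (c - b))))))"
    proof (intro suminf_cong arg_cong[where f = ennreal])
      fix n :: nat
      have "r powr (b + n - 1) = r powr (b - 1) * r ^ n"
        using r by (simp add: powr_diff powr_add powr_realpow)
      \<comment> \<open>The s- and v-integrals supply the exponents -a and -(c-a+n). Their total c +
        n is written as (b+n) + (c-b) to fit the Beta integral in r.\<close>
      moreover have "(1 + r) powr (- ((b + n) + (c - b))) = (1 + r) powr (- a) * (1 + r) powr (- (c - a + n))"
        by (simp only: powr_add[symmetric]) (simp add: algebra_simps)
      ultimately show "(1 - q) powr b * r powr (b - 1) * (Gamma a * (1 + r) powr (- a)) * h n =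
        K n * (r powr (b + n - 1) * (1 + r) powr (- ((b + n) + (c - b))))"
        by (simp only: h_def K_def power_mult_distrib) (simp only: mult_ac times_divide_eq_left times_divide_eq_right)
    qed
    finally show ?thesis .
  qed
  have "(\<integral>\<^sup>+(s, v, u). ?F s v u \<partial>octant) = (\<integral>\<^sup>+s. \<integral>\<^sup>+v. \<integral>\<^sup>+u. ?F s v u \<partial>pos_lborel \<partial>pos_lborel \<partial>pos_lborel)"
  proof -
    have "(\<lambda>(s, v, u). ?F s v u) \<in> borel_measurable (borel \<Otimes>\<^sub>M (borel \<Otimes>\<^sub>M borel))"
      by measurable
    from nn_integral_octant[OF measurable_octant[OF this]] show ?thesis by (simp only: prod.case)
  qed
  also have "\<dots> = (\<integral>\<^sup>+s. \<integral>\<^sup>+v. \<integral>\<^sup>+r. G s v r \<partial>pos_lborel \<partial>pos_lborel \<partial>pos_lborel)"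
    by (rule nn_integral_cong, rule nn_integral_cong, rule subst) simp_all
  \<comment> \<open>Two Tonelli swaps make r outermost, the variable left for the Beta
    integral.\<close>
  also have "\<dots> = (\<integral>\<^sup>+s. \<integral>\<^sup>+r. \<integral>\<^sup>+v. G s v r \<partial>pos_lborel \<partial>pos_lborel \<partial>pos_lborel)"
    by (rule nn_integral_cong, rule pos_lborel_pair.Fubini', rule measurable_pos_lborel2) (unfold G_def, measurable)
  also have "\<dots> = (\<integral>\<^sup>+r. \<integral>\<^sup>+s. \<integral>\<^sup>+v. G s v r \<partial>pos_lborel \<partial>pos_lborel \<partial>pos_lborel)"
  proof (rule pos_lborel_pair.Fubini')
    have "(\<lambda>(x, v). G (snd x) v (fst x)) \<in> borel_measurable ((pos_lborel \<Otimes>\<^sub>M pos_lborel) \<Otimes>\<^sub>M pos_lborel)"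
    proof -
      have "(\<lambda>y. (snd (fst y), snd y, fst (fst y))) \<in> ((pos_lborel \<Otimes>\<^sub>M pos_lborel) \<Otimes>\<^sub>M pos_lborel) \<rightarrow>\<^sub>M octant"
        by measurable
      from measurable_compose[OF this measurable_octant[OF G_measurable]] show ?thesis by (simp add: case_prod_beta)
    qed
    from pos_lborel.borel_measurable_nn_integral_fst[OF this]
    show "(\<lambda>(r, s). \<integral>\<^sup>+v. G s v r \<partial>pos_lborel) \<in> borel_measurable (pos_lborel \<Otimes>\<^sub>M pos_lborel)"
      by (simp add: case_prod_beta)
  qed
  also have "\<dots> = (\<integral>\<^sup>+r. (\<Sum>n. ennreal (K n) * ennreal (r powr (b + n - 1) * (1 + r) powr (- ((b + n) + (c - b))))) \<partial>pos_lborel)"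
    using K_nonneg by (intro nn_integral_cong) (simp add: inner ennreal_mult')
  also have "\<dots> = (\<Sum>n. ennreal (K n) * ennreal (Gamma (b + n) * Gamma (c - b) / Gamma ((b + n) + (c - b))))"
  proof -
    have m: "(\<lambda>r. ennreal (r powr (b + n - 1) * (1 + r) powr (- ((b + n) + (c - b))))) \<in> borel_measurable pos_lborel" for n :: nat
      by (intro measurable_pos_lborel) measurable
    have "(\<integral>\<^sup>+r. ennreal (K n) * ennreal (r powr (b + n - 1) * (1 + r) powr (- ((b + n) + (c - b)))) \<partial>pos_lborel) =
        ennreal (K n) * ennreal (Gamma (b + n) * Gamma (c - b) / Gamma ((b + n) + (c - b)))" for n :: nat
      using b cb by (subst nn_integral_cmult[OF m], subst nn_integral_Beta) auto
    then show ?thesis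
      by (subst nn_integral_suminf) (use m in auto)
  qed
  also have "\<dots> = (\<Sum>n. ennreal (K n * (Gamma (b + n) * Gamma (c - b) / Gamma (c + n))))"
    using K_nonneg by (simp add: ennreal_mult'[symmetric] add.commute)
  finally show ?thesis by (simp add: K_def)
qed

subsection \<open>The remainder integral\<close>

text \<open>Modulus of the integrand with the Taylor remainder replaced by its bound, the factor
  |X|^N / N! left out: N powers of s and u gained, N powers of v lost. Here \<sigma> and \<rho>
  stand for Re \<mu> and Re \<nu>.\<close>

definition gamma_weight :: "nat \<Rightarrow> real \<Rightarrow> real \<Rightarrow> real \<times> real \<times> real \<Rightarrow> real" where
  "gamma_weight N \<sigma> \<rho> = (\<lambda>(s, v, u). exp ((N - 1/2 - \<sigma>) * ln s + (\<rho> - N - 1/2) * ln v + (N - 1/2 + \<sigma>) * ln u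
     - s - v - u))"

lemma gamma_weight_nonneg [simp]: "gamma_weight N \<sigma> \<rho> x \<ge> 0"
  by (simp add: gamma_weight_def case_prod_beta)

lemma gamma_weight_measurable: "gamma_weight N \<sigma> \<rho> \<in> borel_measurable octant"
  by (rule measurable_octant) (simp add: gamma_weight_def)

lemma has_bochner_integral_gamma_weight:
  assumes "\<bar>\<sigma>\<bar> < N + 1/2" "\<rho> > N - 1/2"
  shows "has_bochner_integral octant (gamma_weight N \<sigma> \<rho>)
    (Gamma (N + 1/2 - \<sigma>) * Gamma (N + 1/2 + \<sigma>) * Gamma (\<rho> - N + 1/2))"
proof (rule has_bochner_integral_nn_integral[OF gamma_weight_measurable])
  have pos: "N + 1/2 - \<sigma> > 0" "N + 1/2 + \<sigma> > 0" "\<rho> - N + 1/2 > 0" using assms by auto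
  then show "0 \<le> Gamma (N + 1/2 - \<sigma>) * Gamma (N + 1/2 + \<sigma>) * Gamma (\<rho> - N + 1/2)"
    by (simp add: Gamma_real_pos less_imp_le)
  have "(\<integral>\<^sup>+x. ennreal (gamma_weight N \<sigma> \<rho> x) \<partial>octant) =
    (\<integral>\<^sup>+(s, v, u). ennreal (s powr ((N + 1/2 - \<sigma>) - 1) * v powr ((\<rho> - N + 1/2) - 1) *
      u powr ((N + 1/2 + \<sigma>) - 1) * exp (- s - v - u)) \<partial>octant)"
    by (intro nn_integral_cong)
       (auto simp: gamma_weight_def space_octant powr_def algebra_simps simp flip: exp_add)
  also have "\<dots> = ennreal (Gamma (N + 1/2 - \<sigma>) * Gamma (N + 1/2 + \<sigma>) * Gamma (\<rho> - N + 1/2))"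
    by (rule nn_integral_octant_Gamma[OF pos])
  finally show "(\<integral>\<^sup>+x. ennreal (gamma_weight N \<sigma> \<rho> x) \<partial>octant) = \<dots>" .
qed auto

text \<open>Complex powers are spelled as exponentials of multiples of real logarithms, so the
  integrand is entire in \<mu>, \<nu> and X and no branch enters.\<close>

definition remainder_kernel :: "nat \<Rightarrow> complex \<Rightarrow> complex \<Rightarrow> complex \<Rightarrow> real \<times> real \<times> real \<Rightarrow> complex" where
  "remainder_kernel N \<mu> \<nu> X = (\<lambda>(s, v, u). exp ((- 1/2 - \<mu>) * of_real (ln s) + (\<nu> - 1/2) * of_real (ln v)
     + (\<mu> - 1/2) * of_real (ln u) - of_real (s + v + u)) * exp_rem N (of_real (u * s / v) * X))"

lemma remainder_kernel_measurable: "remainder_kernel N \<mu> \<nu> X \<in> borel_measurable octant"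
  by (rule measurable_octant) (simp add: remainder_kernel_def exp_rem_def)

lemma exp_ln_power:
  assumes "s > 0" "v > 0" "u > (0::real)"
  shows "(u * s / v) ^ n = exp (n * ln s - n * ln v + n * ln u)"
proof -
  have "u * s / v = exp (ln s - ln v + ln u)"
    using assms by (simp add: exp_add exp_diff)
  then show ?thesis
    by (simp add: algebra_simps flip: exp_of_nat_mult)
qed

text \<open>Powers of positive reals have a modulus depending only on the real part of the exponent,
  and p = u s X / v lies in the closed right half plane together with X.\<close>

lemma norm_remainder_kernel_le:
  assumes "x \<in> space octant" "Re X \<ge> 0"
  shows "norm (remainder_kernel N \<mu> \<nu> X x) \<le> norm X ^ N / fact N * gamma_weight N (Re \<mu>) (Re \<nu>) x"
proof -
  obtain s v u where x: "x = (s, v, u)" and pos: "s > 0" "v > 0" "u > 0"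
    using assms(1) by (auto simp: space_octant)
  define E where "E = (- 1/2 - Re \<mu>) * ln s + (Re \<nu> - 1/2) * ln v + (Re \<mu> - 1/2) * ln u - (s + v + u)"
  have "norm (exp_rem N (of_real (u * s / v) * X)) \<le> norm (of_real (u * s / v) * X) ^ N / fact N"
    using pos assms(2) by (intro norm_exp_rem_le) simp
  also have "norm (of_real (u * s / v) * X) ^ N = (u * s / v) ^ N * norm X ^ N"
    using pos by (simp add: norm_mult norm_divide power_mult_distrib power_divide)
  also have "(u * s / v) ^ N = exp (N * ln s - N * ln v + N * ln u)"
    by (rule exp_ln_power[OF pos])
  finally have le: "norm (exp_rem N (of_real (u * s / v) * X)) \<le> exp (N * ln s - N * ln v + N * ln u) * norm X ^ N / fact N" .
  have "norm (remainder_kernel N \<mu> \<nu> X x) = exp E * norm (exp_rem N (of_real (u * s / v) * X))"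
    by (simp add: x remainder_kernel_def norm_mult E_def)
  also have "\<dots> \<le> exp E * (exp (N * ln s - N * ln v + N * ln u) * norm X ^ N / fact N)"
    using le by (rule mult_left_mono) simp
  also have "\<dots> = norm X ^ N / fact N * (exp E * exp (N * ln s - N * ln v + N * ln u))"
    by simp
  also have "exp E * exp (N * ln s - N * ln v + N * ln u) = gamma_weight N (Re \<mu>) (Re \<nu>) x"
    by (simp add: x gamma_weight_def E_def algebra_simps flip: exp_add)
  finally show ?thesis .
qed

lemma integrable_remainder_kernel:
  assumes "\<bar>Re \<mu>\<bar> < N + 1/2" "Re \<nu> > N - 1/2" "Re X \<ge> 0"
  shows "integrable octant (remainder_kernel N \<mu> \<nu> X)"
proof (rule Bochner_Integration.integrable_bound)
  show "integrable octant (\<lambda>x. norm X ^ N / fact N * gamma_weight N (Re \<mu>) (Re \<nu>) x)"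
    using has_bochner_integral_gamma_weight[OF assms(1,2)] by (auto simp: has_bochner_integral_iff)
  show "AE x in octant. norm (remainder_kernel N \<mu> \<nu> X x) \<le> norm (norm X ^ N / fact N * gamma_weight N (Re \<mu>) (Re \<nu>) x)"
    using norm_remainder_kernel_le assms(3) by (auto intro!: AE_I2)
qed (rule remainder_kernel_measurable)

definition remainder_integral :: "nat \<Rightarrow> complex \<Rightarrow> complex \<Rightarrow> complex \<Rightarrow> complex" where
  "remainder_integral N \<mu> \<nu> X = (\<integral>x. remainder_kernel N \<mu> \<nu> X x \<partial>octant)"

lemma norm_remainder_integral_le:
  assumes "\<bar>Re \<mu>\<bar> < N + 1/2" "Re \<nu> > N - 1/2" "Re X \<ge> 0"
  shows "norm (remainder_integral N \<mu> \<nu> X) \<le> norm X ^ N / fact N *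
    (Gamma (N + 1/2 - Re \<mu>) * Gamma (N + 1/2 + Re \<mu>) * Gamma (Re \<nu> - N + 1/2))"
proof -
  have "norm (remainder_integral N \<mu> \<nu> X) \<le> (\<integral>x. norm X ^ N / fact N * gamma_weight N (Re \<mu>) (Re \<nu>) x \<partial>octant)"
    unfolding remainder_integral_def
    using has_bochner_integral_gamma_weight[OF assms(1,2)] norm_remainder_kernel_le assms(3)
    by (intro Bochner_Integration.integral_norm_bound_integral integrable_remainder_kernel assms) (auto simp: has_bochner_integral_iff)
  then show ?thesis
    using has_bochner_integral_gamma_weight[OF assms(1,2)] by (simp add: has_bochner_integral_iff)
qed

text \<open>\<open>L\<close> may have either sign, so the endpoint with the larger value is not
  known in advance; the sum dominates both.\<close>

lemma exp_mult_le_add: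
  fixes L :: real
  assumes "x \<in> {a..b}"
  shows "exp (x * L) \<le> exp (a * L) + exp (b * L)"
proof (cases "L \<ge> 0")
  case True
  then have "exp (x * L) \<le> exp (b * L)" using assms by (simp add: mult_right_mono)
  then show ?thesis by (simp add: add_increasing)
next
  case False
  then have "exp (x * L) \<le> exp (a * L)" using assms by (simp add: mult_right_mono_neg)
  then show ?thesis by (simp add: add_increasing2)
qed

text \<open>Provides one integrable majorant for a whole rectangle of parameters. The exponent is
  linear in \<sigma> and in \<rho>, so the four corners suffice.\<close>

lemma gamma_weight_le:
  assumes "\<sigma> \<in> {\<sigma>1..\<sigma>2}" "\<rho> \<in> {\<rho>1..\<rho>2}"
  shows "gamma_weight N \<sigma> \<rho> x \<le> gamma_weight N \<sigma>1 \<rho>1 x + gamma_weight N \<sigma>1 \<rho>2 x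
    + gamma_weight N \<sigma>2 \<rho>1 x + gamma_weight N \<sigma>2 \<rho>2 x"
proof -
  obtain s v u where x: "x = (s, v, u)" by (cases x)
  define E where "E = exp ((N - 1/2) * ln s + (- N - 1/2) * ln v + (N - 1/2) * ln u - s - v - u)"
  have eq: "gamma_weight N a b x = E * (exp (a * (ln u - ln s)) * exp (b * ln v))" for a b
    by (simp add: x gamma_weight_def E_def algebra_simps flip: exp_add)
  have "gamma_weight N \<sigma> \<rho> x \<le> E * ((exp (\<sigma>1 * (ln u - ln s)) + exp (\<sigma>2 * (ln u - ln s))) *
      (exp (\<rho>1 * ln v) + exp (\<rho>2 * ln v)))"
    unfolding eq using assms by (intro mult_left_mono mult_mono exp_mult_le_add) (auto simp: E_def)
  then show ?thesis by (simp add: eq algebra_simps)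
qed

text \<open>The bounds are attained, so that the corner parameters inherit the strict inequalities
  that integrability requires.\<close>

lemma compact_range_bounds:
  fixes f :: "'a :: topological_space \<Rightarrow> real"
  assumes "compact C" "C \<noteq> {}" "continuous_on C f"
  obtains a b where "a \<in> f ` C" "b \<in> f ` C" "f ` C \<subseteq> {a..b}"
proof -
  have c: "compact (f ` C)" "f ` C \<noteq> {}" using assms compact_continuous_image by auto
  obtain a where a: "a \<in> f ` C" "\<forall>x\<in>f ` C. a \<le> x" using compact_attains_inf[OF c] by blast
  obtain b where b: "b \<in> f ` C" "\<forall>x\<in>f ` C. x \<le> b" using compact_attains_sup[OF c] by blast
  show ?thesis
    by (rule that[OF a(1) b(1)]) (use a b in auto)
qed

text \<open>The parameters are functions of \<open>t\<close>, so that one lemma serves the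
  continuations in \<mu>, in \<nu> and in q.\<close>

lemma holomorphic_on_remainder_integral:
  fixes m n X :: "complex \<Rightarrow> complex"
  assumes S: "open S" and hol: "m holomorphic_on S" "n holomorphic_on S" "X holomorphic_on S"
    and m: "\<And>t. t \<in> S \<Longrightarrow> \<bar>Re (m t)\<bar> < N + 1/2" and n: "\<And>t. t \<in> S \<Longrightarrow> Re (n t) > N - 1/2"
    and X: "\<And>t. t \<in> S \<Longrightarrow> Re (X t) \<ge> 0"
  shows "(\<lambda>t. remainder_integral N (m t) (n t) (X t)) holomorphic_on S"
  unfolding remainder_integral_def
proof (rule holomorphic_on_integral[OF S])
  show "remainder_kernel N (m t) (n t) (X t) \<in> borel_measurable octant" for t
    by (rule remainder_kernel_measurable)
  show "(\<lambda>t. remainder_kernel N (m t) (n t) (X t) x) holomorphic_on S" for x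
    by (cases x) (auto simp: remainder_kernel_def exp_rem_def intro!: holomorphic_intros hol)
  fix z assume "z \<in> S"
  then obtain r where r: "r > 0" "cball z r \<subseteq> S"
    using S by (auto simp: open_contains_cball)
  have ne: "cball z r \<noteq> {}" using r by auto
  have cont: "continuous_on (cball z r) m" "continuous_on (cball z r) n" "continuous_on (cball z r) X"
    using hol r(2) by (auto intro: holomorphic_on_imp_continuous_on holomorphic_on_subset)
  have cont': "continuous_on (cball z r) (\<lambda>t. Re (m t))" "continuous_on (cball z r) (\<lambda>t. Re (n t))"
    "continuous_on (cball z r) (\<lambda>t. norm (X t))"
    by (intro continuous_intros cont)+
  obtain \<sigma>1 \<sigma>2 where \<sigma>: "\<sigma>1 \<in> (\<lambda>t. Re (m t)) ` cball z r" "\<sigma>2 \<in> (\<lambda>t. Re (m t)) ` cball z r"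
      "(\<lambda>t. Re (m t)) ` cball z r \<subseteq> {\<sigma>1..\<sigma>2}"
    by (rule compact_range_bounds[OF compact_cball ne cont'(1)])
  obtain \<rho>1 \<rho>2 where \<rho>: "\<rho>1 \<in> (\<lambda>t. Re (n t)) ` cball z r" "\<rho>2 \<in> (\<lambda>t. Re (n t)) ` cball z r"
      "(\<lambda>t. Re (n t)) ` cball z r \<subseteq> {\<rho>1..\<rho>2}"
    by (rule compact_range_bounds[OF compact_cball ne cont'(2)])
  obtain A B where AB: "(\<lambda>t. norm (X t)) ` cball z r \<subseteq> {A..B}"
    by (rule compact_range_bounds[OF compact_cball ne cont'(3)])
  define g where "g = (\<lambda>x. B ^ N / fact N * (gamma_weight N \<sigma>1 \<rho>1 x + gamma_weight N \<sigma>1 \<rho>2 x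
    + gamma_weight N \<sigma>2 \<rho>1 x + gamma_weight N \<sigma>2 \<rho>2 x))"
  have int: "integrable octant (gamma_weight N a b)" if "a \<in> {\<sigma>1, \<sigma>2}" "b \<in> {\<rho>1, \<rho>2}" for a b
  proof -
    have "\<bar>a\<bar> < N + 1/2" "b > N - 1/2" using that \<sigma>(1,2) \<rho>(1,2) m n r(2) by (auto simp: subset_iff)
    then show ?thesis using has_bochner_integral_gamma_weight by (auto simp: has_bochner_integral_iff)
  qed
  have "integrable octant g"
    unfolding g_def by (intro integrable_mult_right Bochner_Integration.integrable_add int) auto
  moreover have "norm (remainder_kernel N (m w) (n w) (X w) x) \<le> g x"
    if w: "w \<in> cball z r" and x: "x \<in> space octant" for w x
  proof -
    have "norm (remainder_kernel N (m w) (n w) (X w) x) \<le> norm (X w) ^ N / fact N * gamma_weight N (Re (m w)) (Re (n w)) x"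
      using w r(2) by (intro norm_remainder_kernel_le x X) auto
    also have "\<dots> \<le> g x"
      unfolding g_def using w \<sigma>(3) \<rho>(3) AB order_trans[OF norm_ge_zero, of "X w" B]
      by (intro mult_mono gamma_weight_le divide_right_mono power_mono) (auto simp: image_subset_iff)
    finally show ?thesis .
  qed
  ultimately show "\<exists>r>0. \<exists>g. cball z r \<subseteq> S \<and> integrable octant g \<and>
      (\<forall>w\<in>cball z r. \<forall>x\<in>space octant. norm (remainder_kernel N (m w) (n w) (X w) x) \<le> g x)"
    using r by blast
qed

subsection \<open>The regularised hypergeometric series\<close>

definition hyp_series :: "complex \<Rightarrow> complex \<Rightarrow> complex \<Rightarrow> complex \<Rightarrow> complex" where
  "hyp_series a b c q = (\<Sum>n. pochhammer a n * pochhammer b n * rGamma (c + of_nat n) / fact n * q ^ n)"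

lemma norm_pochhammer_le:
  fixes a :: complex
  assumes "norm a \<le> A"
  shows "norm (pochhammer a n) \<le> pochhammer A n"
proof -
  have "norm (a + of_nat i) \<le> A + i" for i
    using assms norm_triangle_le[of a "of_nat i"] by simp
  then show ?thesis
    by (simp add: pochhammer_prod flip: prod_norm) (intro prod_mono, auto)
qed

lemma pochhammer_le_norm:
  fixes c :: complex
  assumes "0 < c0" "c0 \<le> Re c"
  shows "pochhammer c0 n \<le> norm (pochhammer c n)"
proof -
  have "c0 + i \<le> norm (c + of_nat i)" for i
    using assms(2) complex_Re_le_cmod[of "c + of_nat i"] by simp
  then show ?thesis
    using assms(1) by (simp add: pochhammer_prod flip: prod_norm) (intro prod_mono, auto)
qed

lemma summable_hyp_majorant:
  fixes A c Q :: real
  assumes "A > 0" "c > 0" "0 \<le> Q" "Q < 1"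
  shows "summable (\<lambda>n. pochhammer A n * pochhammer A n / (pochhammer c n * fact n) * Q ^ n)"
    (is "summable ?f")
proof -
  have f: "?f (Suc n) = ((A + n) / (c + n)) * ((A + n) / (1 + real n)) * Q * ?f n" for n
    by (simp add: pochhammer_Suc field_simps)
  have lim: "(\<lambda>n. (A + real n) / (d + real n)) \<longlonglongrightarrow> 1" if "d > 0" for d :: real
  proof -
    have "(\<lambda>n. 1 + (A - d) / (d + real n)) \<longlonglongrightarrow> 1 + 0"
      by (intro tendsto_intros tendsto_divide_0[OF tendsto_const] filterlim_at_top_imp_at_infinity
            filterlim_tendsto_add_at_top[OF tendsto_const] filterlim_real_sequentially)
    moreover have "1 + (A - d) / (d + real n) = (A + real n) / (d + real n)" for n
      using that by (simp add: field_simps add_pos_nonneg less_imp_neq[symmetric])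
    ultimately show ?thesis by simp
  qed
  have "(\<lambda>n. ((A + real n) / (c + real n)) * ((A + real n) / (1 + real n)) * Q) \<longlonglongrightarrow> 1 * 1 * Q"
    using assms by (intro tendsto_mult lim tendsto_const) auto
  \<comment> \<open>The term ratios tend to Q; the midpoint between Q and 1 eventually bounds them
    and is still below 1.\<close>
  moreover have "1 * 1 * Q < (1 + Q) / 2" using assms by simp
  ultimately have "eventually (\<lambda>n. ((A + real n) / (c + real n)) * ((A + real n) / (1 + real n)) * Q < (1 + Q) / 2) sequentially"
    by (rule order_tendstoD(2))
  then obtain N where N: "\<And>n. n \<ge> N \<Longrightarrow> ((A + real n) / (c + real n)) * ((A + real n) / (1 + real n)) * Q < (1 + Q) / 2"
    by (auto simp: eventually_sequentially)
  show ?thesis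
  proof (rule summable_ratio_test[of "(1 + Q) / 2" N])
    show "(1 + Q) / 2 < 1" using assms by simp
    fix n assume "N \<le> n"
    have "?f n \<ge> 0" using assms by (auto intro!: mult_nonneg_nonneg divide_nonneg_nonneg pochhammer_nonneg)
    moreover have "?f (Suc n) \<ge> 0" using assms by (auto intro!: mult_nonneg_nonneg divide_nonneg_nonneg pochhammer_nonneg)
    moreover have "?f (Suc n) \<le> (1 + Q) / 2 * ?f n"
      unfolding f using N[OF \<open>N \<le> n\<close>] \<open>?f n \<ge> 0\<close> by (intro mult_right_mono) auto
    ultimately show "norm (?f (Suc n)) \<le> (1 + Q) / 2 * norm (?f n)"
      by (simp only: real_norm_def abs_of_nonneg)
  qed
qed

lemma norm_rGamma_plus_of_nat_le:
  assumes "0 < c0" "c0 \<le> Re c"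
  shows "norm (rGamma (c + of_nat n)) \<le> norm (rGamma c) / pochhammer c0 n"
proof -
  have pos: "pochhammer c0 n > 0" using assms by (intro pochhammer_pos)
  have le: "pochhammer c0 n \<le> norm (pochhammer c n)" using assms by (intro pochhammer_le_norm)
  have nz: "pochhammer c n \<noteq> 0" using pos le by auto
  have "rGamma (c + of_nat n) = rGamma c / pochhammer c n"
    using nz pochhammer_rGamma[of c n] by (simp add: field_simps)
  then show ?thesis
    using pos le by (auto simp: norm_divide intro!: divide_left_mono mult_pos_pos)
qed

lemma norm_hyp_term_le:
  assumes "norm a \<le> A" "norm b \<le> A" "0 < A" "0 < c0" "c0 \<le> Re c" "norm q \<le> Q"
  shows "norm (pochhammer a n * pochhammer b n * rGamma (c + of_nat n) / fact n * q ^ n) \<le>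
    norm (rGamma c) * (pochhammer A n * pochhammer A n / (pochhammer c0 n * fact n) * Q ^ n)"
proof -
  have "norm (pochhammer a n * pochhammer b n * rGamma (c + of_nat n) / fact n * q ^ n) =
    norm (pochhammer a n) * norm (pochhammer b n) * norm (rGamma (c + of_nat n)) / fact n * norm q ^ n"
    by (simp add: norm_mult norm_divide norm_power)
  also have "\<dots> \<le> pochhammer A n * pochhammer A n * (norm (rGamma c) / pochhammer c0 n) / fact n * Q ^ n"
    using assms pochhammer_pos[of c0 n]
    by (intro mult_mono divide_right_mono norm_rGamma_plus_of_nat_le norm_pochhammer_le power_mono mult_nonneg_nonneg
          pochhammer_nonneg divide_nonneg_nonneg) auto
  finally show ?thesis by (simp add: field_simps)
qed

lemma summable_norm_hyp_term:
  assumes "Re c > 0" "norm q < 1"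
  shows "summable (\<lambda>n. norm (pochhammer a n * pochhammer b n * rGamma (c + of_nat n) / fact n * q ^ n))"
proof (rule summable_comparison_test')
  define A where "A = norm a + norm b + 1"
  have A: "A > 0" by (simp add: A_def add_nonneg_pos)
  show "summable (\<lambda>n. norm (rGamma c) * (pochhammer A n * pochhammer A n / (pochhammer (Re c) n * fact n) * norm q ^ n))"
    using assms by (intro summable_mult summable_hyp_majorant A) auto
  show "norm (norm (pochhammer a n * pochhammer b n * rGamma (c + of_nat n) / fact n * q ^ n)) \<le>
     norm (rGamma c) * (pochhammer A n * pochhammer A n / (pochhammer (Re c) n * fact n) * norm q ^ n)" if "n \<ge> 0" for n
    using norm_hyp_term_le[of a A b "Re c" c q "norm q" n] assms A by (simp add: A_def add_increasing add_increasing2)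
qed

lemma sums_hyp_series:
  assumes "Re c > 0" "norm q < 1"
  shows "(\<lambda>n. pochhammer a n * pochhammer b n * rGamma (c + of_nat n) / fact n * q ^ n) sums hyp_series a b c q"
  unfolding hyp_series_def
  using summable_norm_cancel[OF summable_norm_hyp_term[OF assms]] by (rule summable_sums)

text \<open>On a small closed disc compactness replaces the pointwise conditions by constants
  \<open>c0\<close> > 0 and \<open>Q\<close> < 1, which give the Weierstrass test a summable
  majorant.\<close>

lemma holomorphic_on_hyp_series:
  fixes a b c q :: "complex \<Rightarrow> complex"
  assumes S: "open S" and hol: "a holomorphic_on S" "b holomorphic_on S" "c holomorphic_on S" "q holomorphic_on S"
    and c: "\<And>t. t \<in> S \<Longrightarrow> Re (c t) > 0" and q: "\<And>t. t \<in> S \<Longrightarrow> norm (q t) < 1"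
  shows "(\<lambda>t. hyp_series (a t) (b t) (c t) (q t)) holomorphic_on S"
proof (rule holomorphic_uniform_sequence[OF S])
  let ?t = "\<lambda>n t. pochhammer (a t) n * pochhammer (b t) n * rGamma (c t + of_nat n) / fact n * q t ^ n"
  show "(\<lambda>t. \<Sum>k<n. ?t k t) holomorphic_on S" for n
    by (auto simp: pochhammer_prod intro!: holomorphic_intros hol)
  fix z assume "z \<in> S"
  then obtain r where r: "r > 0" "cball z r \<subseteq> S"
    using S by (auto simp: open_contains_cball)
  have ne: "cball z r \<noteq> {}" using r by auto
  have cont: "continuous_on (cball z r) a" "continuous_on (cball z r) b" "continuous_on (cball z r) c" "continuous_on (cball z r) q"
    using hol r(2) by (auto intro: holomorphic_on_imp_continuous_on holomorphic_on_subset)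
  have "(\<lambda>t. rGamma (c t)) holomorphic_on S" by (intro holomorphic_intros hol)
  then have contg: "continuous_on (cball z r) (\<lambda>t. rGamma (c t))"
    using r(2) by (auto intro: holomorphic_on_imp_continuous_on holomorphic_on_subset)
  have cont': "continuous_on (cball z r) (\<lambda>t. norm (a t) + norm (b t) + 1)"
    "continuous_on (cball z r) (\<lambda>t. Re (c t))" "continuous_on (cball z r) (\<lambda>t. norm (q t))"
    "continuous_on (cball z r) (\<lambda>t. norm (rGamma (c t)))"
    by (intro continuous_intros cont contg)+
  obtain A0 A where A: "A \<in> (\<lambda>t. norm (a t) + norm (b t) + 1) ` cball z r" "(\<lambda>t. norm (a t) + norm (b t) + 1) ` cball z r \<subseteq> {A0..A}"
    by (rule compact_range_bounds[OF compact_cball ne cont'(1)])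
  obtain c0 c1 where c0: "c0 \<in> (\<lambda>t. Re (c t)) ` cball z r" "(\<lambda>t. Re (c t)) ` cball z r \<subseteq> {c0..c1}"
    by (rule compact_range_bounds[OF compact_cball ne cont'(2)])
  obtain Q0 Q where Q: "Q \<in> (\<lambda>t. norm (q t)) ` cball z r" "(\<lambda>t. norm (q t)) ` cball z r \<subseteq> {Q0..Q}"
    by (rule compact_range_bounds[OF compact_cball ne cont'(3)])
  obtain G0 G where G: "(\<lambda>t. norm (rGamma (c t))) ` cball z r \<subseteq> {G0..G}"
    by (rule compact_range_bounds[OF compact_cball ne cont'(4)])
  have pos: "A > 0" "c0 > 0" "Q \<ge> 0" "Q < 1"
    using A(1) c0(1) Q(1) c q r(2) by (auto simp: add_nonneg_pos)
  have "uniform_limit (cball z r) (\<lambda>n t. \<Sum>k<n. ?t k t) (\<lambda>t. \<Sum>k. ?t k t) sequentially"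
  proof (rule Weierstrass_m_test)
    show "summable (\<lambda>n. G * (pochhammer A n * pochhammer A n / (pochhammer c0 n * fact n) * Q ^ n))"
      by (intro summable_mult summable_hyp_majorant pos)
    fix n t assume t: "t \<in> cball z r"
    have ab: "norm (a t) + norm (b t) + 1 \<le> A" using A(2) t by (auto simp: image_subset_iff)
    have "norm (?t n t) \<le> norm (rGamma (c t)) * (pochhammer A n * pochhammer A n / (pochhammer c0 n * fact n) * Q ^ n)"
    proof (rule norm_hyp_term_le)
      show "norm (a t) \<le> A" using ab norm_ge_zero[of "b t"] by linarith
      show "norm (b t) \<le> A" using ab norm_ge_zero[of "a t"] by linarith
    qed (use t c0(2) Q(2) pos in \<open>auto simp: image_subset_iff\<close>)
    also have "\<dots> \<le> G * (pochhammer A n * pochhammer A n / (pochhammer c0 n * fact n) * Q ^ n)"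
      using t G pos by (intro mult_right_mono) (auto simp: image_subset_iff intro!: mult_nonneg_nonneg divide_nonneg_nonneg pochhammer_nonneg)
    finally show "norm (?t n t) \<le> G * (pochhammer A n * pochhammer A n / (pochhammer c0 n * fact n) * Q ^ n)" .
  qed
  then show "\<exists>d>0. cball z d \<subseteq> S \<and> uniform_limit (cball z d) (\<lambda>n t. \<Sum>k<n. ?t k t) (\<lambda>t. hyp_series (a t) (b t) (c t) (q t)) sequentially"
    using r unfolding hyp_series_def by blast
qed

subsection \<open>The connection formula\<close>

lemma complex_nonpole: "Re z > 0 \<Longrightarrow> z \<notin> \<int>\<^sub>\<le>\<^sub>0"
  by (auto elim!: nonpos_Ints_cases)

text \<open>Reflection at 1/2 + \<mu>, then n shifts in each factor. The argument runs on
  \<open>rGamma\<close> because 1/2 - \<mu> or 1/2 + \<mu> may be a pole of Gamma; the hypothesis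
  keeps only the shifted arguments off the poles.\<close>

lemma pochhammer_half_reflection:
  fixes \<mu> :: complex
  assumes "\<bar>Re \<mu>\<bar> < n + 1/2"
  shows "pochhammer (1/2 - \<mu>) n * pochhammer (1/2 + \<mu>) n =
    cos (of_real pi * \<mu>) / of_real pi * (Gamma (of_nat n + 1/2 - \<mu>) * Gamma (of_nat n + 1/2 + \<mu>))"
proof -
  let ?g = "rGamma (of_nat n + 1/2 - \<mu>)" and ?h = "rGamma (of_nat n + 1/2 + \<mu>)"
  have "rGamma (1/2 + \<mu>) * rGamma (1 - (1/2 + \<mu>)) = sin (of_real pi * (1/2 + \<mu>)) / of_real pi"
    by (rule rGamma_reflection_complex)
  also have "sin (of_real pi * (1/2 + \<mu>)) = cos (of_real pi * \<mu>)"
    by (simp only: ring_distribs sin_add mult_1_right times_divide_eq_right cos_of_real_pi_half sin_of_real_pi_half)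
       simp
  finally have "cos (of_real pi * \<mu>) / of_real pi = rGamma (1/2 - \<mu>) * rGamma (1/2 + \<mu>)"
    by (simp add: algebra_simps)
  also have "\<dots> = pochhammer (1/2 - \<mu>) n * pochhammer (1/2 + \<mu>) n * (?g * ?h)"
    by (subst pochhammer_rGamma[of "1/2 - \<mu>" n], subst pochhammer_rGamma[of "1/2 + \<mu>" n])
       (simp add: algebra_simps)
  finally have eq: "cos (of_real pi * \<mu>) / of_real pi = pochhammer (1/2 - \<mu>) n * pochhammer (1/2 + \<mu>) n * (?g * ?h)" .
  have "?g * Gamma (of_nat n + 1/2 - \<mu>) = 1" "?h * Gamma (of_nat n + 1/2 + \<mu>) = 1"
    using assms by (auto simp: rGamma_inverse_Gamma Gamma_eq_zero_iff complex_nonpole)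
  then have "pochhammer (1/2 - \<mu>) n * pochhammer (1/2 + \<mu>) n * ((?g * Gamma (of_nat n + 1/2 - \<mu>)) * (?h * Gamma (of_nat n + 1/2 + \<mu>))) =
      pochhammer (1/2 - \<mu>) n * pochhammer (1/2 + \<mu>) n"
    by simp
  then show ?thesis unfolding eq by (simp only: mult_ac)
qed

lemma pochhammer_half_reflection_real:
  fixes m :: real
  assumes "\<bar>m\<bar> < n + 1/2"
  shows "pochhammer (1/2 - m) n * pochhammer (1/2 + m) n =
    cos (pi * m) / pi * (Gamma (n + 1/2 - m) * Gamma (n + 1/2 + m))"
proof -
  have "complex_of_real (pochhammer (1/2 - m) n * pochhammer (1/2 + m) n) =
     pochhammer (1/2 - of_real m) n * pochhammer (1/2 + of_real m) n"
    by (simp flip: pochhammer_of_real)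
  also have "\<dots> = of_real (cos (pi * m) / pi * (Gamma (n + 1/2 - m) * Gamma (n + 1/2 + m)))"
    using assms by (subst pochhammer_half_reflection) (simp_all add: Gamma_complex_of_real[symmetric] cos_of_real[symmetric])
  finally show ?thesis by (simp only: of_real_eq_iff)
qed

section \<open>The identity for real parameters\<close>

definition real_kernel :: "nat \<Rightarrow> real \<Rightarrow> real \<Rightarrow> real \<Rightarrow> real \<times> real \<times> real \<Rightarrow> real" where
  "real_kernel N m n X = (\<lambda>(s, v, u). exp ((- 1/2 - m) * ln s + (n - 1/2) * ln v
     + (m - 1/2) * ln u - (s + v + u)) * exp_rem N (u * s / v * X))"

lemma remainder_kernel_of_real:
  "remainder_kernel N (of_real m) (of_real n) (of_real X) = (\<lambda>x. of_real (real_kernel N m n X x))"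
proof
  fix x :: "real \<times> real \<times> real"
  obtain s v u where x: "x = (s, v, u)" by (cases x)
  show "remainder_kernel N (of_real m) (of_real n) (of_real X) x = of_real (real_kernel N m n X x)"
    by (simp add: x remainder_kernel_def real_kernel_def exp_of_real[symmetric] exp_rem_of_real[symmetric])
qed

lemma integrable_real_kernel:
  fixes m n X :: real
  assumes "\<bar>m\<bar> < N + 1/2" "n > N - 1/2" "X \<ge> 0"
  shows "integrable octant (real_kernel N m n X)"
  using integrable_remainder_kernel[of "of_real m" N "of_real n" "of_real X"] assms
  by (simp add: remainder_kernel_of_real complex_of_real_integrable_eq)

lemma remainder_integral_of_real:
  "remainder_integral N (of_real m) (of_real n) (of_real X) = of_real (\<integral>x. real_kernel N m n X x \<partial>octant)"
  by (simp add: remainder_integral_def remainder_kernel_of_real)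

text \<open>Multiplying the integrand by p^k only shifts exponents, which is what
  \<open>gamma_weight k\<close> records; the subtracted terms thus integrate to Gamma
  products.\<close>

lemma real_kernel_expand:
  fixes m n X :: real
  assumes "x \<in> space octant"
  shows "real_kernel N m n X x = real_kernel 0 m n X x - (\<Sum>k<N. (- X) ^ k / fact k * gamma_weight k m n x)"
proof -
  obtain s v u where x: "x = (s, v, u)" and pos: "s > 0" "v > 0" "u > 0"
    using assms by (auto simp: space_octant)
  define E where "E = (- 1/2 - m) * ln s + (n - 1/2) * ln v + (m - 1/2) * ln u - (s + v + u)"
  have term_eq: "exp E * ((- (u * s / v * X)) ^ k / fact k) = (- X) ^ k / fact k * gamma_weight k m n x" for k
  proof -
    have "- (u * s / v * X) = (- X) * (u * s / v)" by simp
    then have "exp E * ((- (u * s / v * X)) ^ k / fact k) = (- X) ^ k / fact k * (exp E * (u * s / v) ^ k)"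
      by (simp only: power_mult_distrib) simp
    also have "exp E * (u * s / v) ^ k = gamma_weight k m n x"
      unfolding exp_ln_power[OF pos]
      by (simp add: x gamma_weight_def E_def algebra_simps flip: exp_add)
    finally show ?thesis .
  qed
  have "real_kernel N m n X x = exp E * exp (- (u * s / v * X)) - (\<Sum>k<N. exp E * ((- (u * s / v * X)) ^ k / fact k))"
    by (simp add: x real_kernel_def exp_rem_def E_def right_diff_distrib sum_distrib_left)
  also have "exp E * exp (- (u * s / v * X)) = real_kernel 0 m n X x"
    by (simp add: x real_kernel_def exp_rem_def E_def)
  finally show ?thesis by (simp only: term_eq)
qed

text \<open>In this range of \<open>m\<close> and \<open>n\<close> the unsubtracted kernel and every
  weight with k < N are integrable separately, so the integral may be split.\<close>

lemma integral_real_kernel: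
  fixes m n X :: real
  assumes "\<bar>m\<bar> < 1/2" "n > N - 1/2" "n > -1/2" "X \<ge> 0"
  shows "(\<integral>x. real_kernel N m n X x \<partial>octant) = (\<integral>x. real_kernel 0 m n X x \<partial>octant) -
    (\<Sum>k<N. (- X) ^ k / fact k * (Gamma (k + 1/2 - m) * Gamma (k + 1/2 + m) * Gamma (n - k + 1/2)))"
proof -
  have G: "has_bochner_integral octant (gamma_weight k m n)
      (Gamma (k + 1/2 - m) * Gamma (k + 1/2 + m) * Gamma (n - k + 1/2))" if "k < N" for k
    using assms that by (intro has_bochner_integral_gamma_weight) auto
  have "(\<integral>x. real_kernel N m n X x \<partial>octant) =
    (\<integral>x. real_kernel 0 m n X x - (\<Sum>k<N. (- X) ^ k / fact k * gamma_weight k m n x) \<partial>octant)"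
    by (intro Bochner_Integration.integral_cong real_kernel_expand refl)
  also have "\<dots> = (\<integral>x. real_kernel 0 m n X x \<partial>octant) - (\<Sum>k<N. (- X) ^ k / fact k * (\<integral>x. gamma_weight k m n x \<partial>octant))"
    using assms G by (subst Bochner_Integration.integral_diff)
      (auto intro!: integrable_real_kernel Bochner_Integration.integrable_sum simp: has_bochner_integral_iff Bochner_Integration.integral_sum)
  also have "\<dots> = (\<integral>x. real_kernel 0 m n X x \<partial>octant) -
    (\<Sum>k<N. (- X) ^ k / fact k * (Gamma (k + 1/2 - m) * Gamma (k + 1/2 + m) * Gamma (n - k + 1/2)))"
    using G by (auto simp: has_bochner_integral_iff)
  finally show ?thesis .
qed

lemma sums_integral_real_kernel_0:
  fixes m n q :: real
  assumes m: "\<bar>m\<bar> < 1/2" and n: "n > -1/2" and q: "0 < q" "q < 1"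
  shows "(\<lambda>j. (1 - q) powr (m + 1/2) * q ^ j / fact j * Gamma (1/2 - m) * Gamma (n + m + 1 + j) *
        (Gamma (m + 1/2 + j) * Gamma (n - m + 1) / Gamma (n + 3/2 + j))) sums
     (\<integral>x. real_kernel 0 m n (1 / (1 - q)) x \<partial>octant)"
proof -
  \<comment> \<open>Chosen so that a-1, b-1 and c-a-b-1 are the exponents of s, u and v in the
    kernel; then c-a = n+m+1 and c-b = n-m+1 are the Gamma arguments in
    \<open>connection_lhs\<close>.\<close>
  define a b c where "a = 1/2 - m" and "b = m + 1/2" and "c = n + 3/2"
  have abc: "a > 0" "b > 0" "c > a" "c > b" and eqs: "c - a = n + m + 1" "c - b = n - m + 1" "c - a - b - 1 = n - 1/2"
    using m n by (auto simp: a_def b_def c_def)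
  let ?t = "\<lambda>j. (1 - q) powr b * q ^ j / fact j * Gamma a * Gamma (c - a + real j) *
        (Gamma (b + j) * Gamma (c - b) / Gamma (c + j))"
  have t: "?t j \<ge> 0" for j
    using abc q by (intro mult_nonneg_nonneg divide_nonneg_nonneg Gamma_real_pos[THEN less_imp_le] zero_le_power)
      (auto simp: add_pos_nonneg)
  have nonneg: "real_kernel 0 m n X x \<ge> 0" for X x
    by (simp add: real_kernel_def exp_rem_def case_prod_beta)
  have "ennreal (\<integral>x. real_kernel 0 m n (1 / (1 - q)) x \<partial>octant) = (\<integral>\<^sup>+x. ennreal (real_kernel 0 m n (1 / (1 - q)) x) \<partial>octant)"
    using m n q nonneg by (intro nn_integral_eq_integral[symmetric] integrable_real_kernel) auto
  also have "\<dots> = (\<integral>\<^sup>+(s, v, u). ennreal (s powr (a - 1) * v powr (c - a - b - 1) * u powr (b - 1) * exp (- s - v - u)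
             * exp (- (u * s / v * (1 / (1 - q))))) \<partial>octant)"
    unfolding eqs
    by (intro nn_integral_cong)
       (auto simp: real_kernel_def exp_rem_def space_octant powr_def a_def b_def algebra_simps simp flip: exp_add)
  also have "\<dots> = (\<Sum>j. ennreal (?t j))"
    by (rule nn_integral_octant_hypergeometric[OF abc q])
  finally have "(\<lambda>j. ennreal (?t j)) sums ennreal (\<integral>x. real_kernel 0 m n (1 / (1 - q)) x \<partial>octant)"
    by (simp add: sums_iff)
  then have "?t sums (\<integral>x. real_kernel 0 m n (1 / (1 - q)) x \<partial>octant)"
    using t nonneg by (subst (asm) sums_ennreal) (auto intro!: Bochner_Integration.integral_nonneg)
  then show ?thesis unfolding eqs unfolding a_def b_def c_def .
qed

text \<open>At q = exp (-2 \<xi>) this is the Legendre function divided by its elementary prefactor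
  and multiplied by Gamma(\<nu>-\<mu>+1); see \<open>legendre_Q_cosh\<close>.\<close>

definition connection_lhs :: "complex \<Rightarrow> complex \<Rightarrow> complex \<Rightarrow> complex" where
  "connection_lhs \<mu> \<nu> q = Gamma (\<nu> - \<mu> + 1) * Gamma (\<nu> + \<mu> + 1) * (1 - q) powr (\<mu> + 1/2) *
     hyp_series (\<nu> + \<mu> + 1) (\<mu> + 1/2) (\<nu> + 3/2) q"

text \<open>The bracket of the expansion: at q = exp (-2 \<xi>) the quantity 2/(1-q) is exp \<xi> /
  sinh \<xi>.\<close>

definition connection_rhs :: "nat \<Rightarrow> complex \<Rightarrow> complex \<Rightarrow> complex \<Rightarrow> complex" where
  "connection_rhs N \<mu> \<nu> q = (\<Sum>k<N. a_coeff k \<mu> * Gamma (\<nu> - of_nat k + 1/2) * (2 / (1 - q)) ^ k) +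
     cos (of_real pi * \<mu>) / of_real pi * remainder_integral N \<mu> \<nu> (1 / (1 - q))"

lemma connection_real:
  fixes m n q :: real
  assumes m: "\<bar>m\<bar> < 1/2" and n: "n > N - 1/2" and q: "0 < q" "q < 1"
  shows "connection_lhs (of_real m) (of_real n) (of_real q) = connection_rhs N (of_real m) (of_real n) (of_real q)"
proof -
  define X where "X = 1 / (1 - q)"
  have X: "X \<ge> 0" using q by (simp add: X_def)
  have n': "n > -1/2" using n of_nat_0_le_iff[of N, where ?'a = real] by linarith
  \<comment> \<open>By reflection \<open>K\<close> is the reciprocal of Gamma(1/2-m) Gamma(1/2+m),
    which normalises both the series and the Taylor terms.\<close>
  define K where "K = cos (pi * m) / pi"
  define I where "I = (\<lambda>N. \<integral>x. real_kernel N m n X x \<partial>octant)"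
  define C where "C = Gamma (n - m + 1) * Gamma (n + m + 1) * (1 - q) powr (m + 1/2)"
  have pos: "n + m + 1 > 0" "m + 1/2 > 0" "1/2 - m > 0" "n + 3/2 > 0" "n - m + 1 > 0" using m n' by auto
  have K: "K * (Gamma (1/2 - m) * Gamma (1/2 + m)) = 1"
    using pochhammer_half_reflection_real[of m 0] m by (simp add: K_def)
  let ?t = "\<lambda>j. pochhammer (n + m + 1) j * pochhammer (m + 1/2) j * rGamma (n + 3/2 + j) / fact j * q ^ j"
  have "K * ((1 - q) powr (m + 1/2) * q ^ j / fact j * Gamma (1/2 - m) * Gamma (n + m + 1 + j) *
        (Gamma (m + 1/2 + j) * Gamma (n - m + 1) / Gamma (n + 3/2 + j))) = C * ?t j" for j
  proof -
    have *: "z \<notin> \<int>\<^sub>\<le>\<^sub>0" if "z > 0" for z :: real using that by (auto elim!: nonpos_Ints_cases)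
    have g: "Gamma (z + j) = pochhammer z j * Gamma z" if "z > 0" for z :: real
      using that less_imp_neq[OF Gamma_real_pos[OF that]] by (subst pochhammer_Gamma) (auto simp: *)
    have "K * ((1 - q) powr (m + 1/2) * q ^ j / fact j * Gamma (1/2 - m) * Gamma (n + m + 1 + j) *
        (Gamma (m + 1/2 + j) * Gamma (n - m + 1) / Gamma (n + 3/2 + j))) =
        (K * (Gamma (1/2 - m) * Gamma (1/2 + m))) * (C * ?t j)"
      unfolding g[OF pos(1)] g[OF pos(2)] C_def rGamma_inverse_Gamma
      by (simp add: field_simps)
    then show ?thesis by (simp only: K mult_1_left)
  qed
  then have "(\<lambda>j. C * ?t j) sums (K * I 0)"
    using sums_mult[OF sums_integral_real_kernel_0[OF m n' q], of K] by (simp only: I_def X_def)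
  then have "(\<lambda>j. complex_of_real (C * ?t j)) sums of_real (K * I 0)"
    by (rule sums_of_real)
  moreover have "(\<lambda>j. complex_of_real (C * ?t j)) sums connection_lhs (of_real m) (of_real n) (of_real q)"
  proof -
    have "complex_of_real C = Gamma (of_real n - of_real m + 1) * Gamma (of_real n + of_real m + 1) * (1 - of_real q) powr (of_real m + 1/2)"
      using q by (simp add: C_def Gamma_complex_of_real[symmetric] powr_of_real[symmetric])
    moreover have "complex_of_real (?t j) = pochhammer (of_real n + of_real m + 1) j * pochhammer (of_real m + 1/2) j *
       rGamma (of_real n + 3/2 + of_nat j) / fact j * of_real q ^ j" for j
      by (simp add: rGamma_complex_of_real[symmetric] pochhammer_of_real[symmetric])
    moreover have "(\<lambda>j. pochhammer (of_real n + of_real m + 1) j * pochhammer (of_real m + 1/2) j *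
       rGamma (of_real n + 3/2 + of_nat j) / fact j * of_real q ^ j) sums
       hyp_series (of_real n + of_real m + 1) (of_real m + 1/2) (of_real n + 3/2) (of_real q)"
      using q pos by (intro sums_hyp_series) auto
    ultimately show ?thesis
      unfolding connection_lhs_def of_real_mult[of C] by (simp only: sums_mult)
  qed
  ultimately have lhs: "connection_lhs (of_real m) (of_real n) (of_real q) = of_real (K * I 0)"
    by (rule sums_unique2[symmetric])
  have "K * I 0 = (\<Sum>k<N. a_coeff k m * Gamma (n - k + 1/2) * (2 / (1 - q)) ^ k) + K * I N"
  proof -
    have "K * ((- X) ^ k / fact k * (Gamma (k + 1/2 - m) * Gamma (k + 1/2 + m) * Gamma (n - k + 1/2))) =
      a_coeff k m * Gamma (n - k + 1/2) * (2 / (1 - q)) ^ k" for k :: nat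
    proof -
      \<comment> \<open>The (-2)^k in the denominator of a_k absorbs the sign of -X and the factor 2
        between X and 2/(1-q).\<close>
      have "- X = (2 / (1 - q)) / (- 2)" using q by (simp add: X_def field_simps)
      then have "(- X) ^ k = (2 / (1 - q)) ^ k / (- 2) ^ k"
        by (simp only: power_divide)
      then have "K * ((- X) ^ k / fact k * (Gamma (k + 1/2 - m) * Gamma (k + 1/2 + m) * Gamma (n - k + 1/2))) =
        (K * (Gamma (k + 1/2 - m) * Gamma (k + 1/2 + m))) * ((2 / (1 - q)) ^ k / (- 2) ^ k / fact k * Gamma (n - k + 1/2))"
        by simp
      also have "K * (Gamma (k + 1/2 - m) * Gamma (k + 1/2 + m)) = pochhammer (1/2 - m) k * pochhammer (1/2 + m) k"
        using m unfolding K_def by (intro pochhammer_half_reflection_real[symmetric]) auto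
      finally show ?thesis by (simp add: a_coeff_pochhammer)
    qed
    then show ?thesis
      using integral_real_kernel[OF m n n' X] by (simp add: I_def right_diff_distrib sum_distrib_left)
  qed
  then have "complex_of_real (K * I 0) = (\<Sum>k<N. of_real (a_coeff k m) * Gamma (of_real n - of_nat k + 1/2) * (2 / (1 - of_real q)) ^ k)
     + cos (of_real pi * of_real m) / of_real pi * remainder_integral N (of_real m) (of_real n) (1 / (1 - of_real q))"
    using remainder_integral_of_real[of N m n X]
    by (simp add: I_def K_def X_def Gamma_complex_of_real[symmetric] cos_of_real[symmetric])
  moreover have "complex_of_real (a_coeff k m) = a_coeff k (of_real m)" for k
    by (simp add: a_coeff_def)
  ultimately show ?thesis by (simp add: lhs connection_rhs_def)
qed

section \<open>Holomorphy of both sides and continuation in the parameters\<close>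

lemma holomorphic_on_connection_lhs:
  fixes m n q :: "complex \<Rightarrow> complex"
  assumes S: "open S" and hol: "m holomorphic_on S" "n holomorphic_on S" "q holomorphic_on S"
    and m: "\<And>t. t \<in> S \<Longrightarrow> \<bar>Re (m t)\<bar> < N + 1/2" and n: "\<And>t. t \<in> S \<Longrightarrow> Re (n t) > N - 1/2"
    and q: "\<And>t. t \<in> S \<Longrightarrow> norm (q t) < 1"
  shows "(\<lambda>t. connection_lhs (m t) (n t) (q t)) holomorphic_on S"
proof -
  \<comment> \<open>N + 1/2 and N - 1/2 differ by exactly 1, so the two conditions together put
    \<nu> \<plusminus> \<mu> + 1 in the right half plane, off the poles of Gamma.\<close>
  have "Re (n t - m t + 1) > 0" "Re (n t + m t + 1) > 0" "Re (n t + 3/2) > 0" if "t \<in> S" for t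
    using m[OF that] n[OF that] by (auto simp: abs_if split: if_splits)
  moreover have "1 - q t \<notin> \<real>\<^sub>\<le>\<^sub>0" if "t \<in> S" for t
    using q[OF that] abs_Re_le_cmod[of "q t"] by (auto simp: complex_nonpos_Reals_iff)
  ultimately show ?thesis
    unfolding connection_lhs_def
    by (intro holomorphic_intros holomorphic_on_hyp_series[OF S] hol complex_nonpole q) auto
qed

lemma holomorphic_on_connection_rhs:
  fixes m n q :: "complex \<Rightarrow> complex"
  assumes S: "open S" and hol: "m holomorphic_on S" "n holomorphic_on S" "q holomorphic_on S"
    and m: "\<And>t. t \<in> S \<Longrightarrow> \<bar>Re (m t)\<bar> < N + 1/2" and n: "\<And>t. t \<in> S \<Longrightarrow> Re (n t) > N - 1/2"
    and q: "\<And>t. t \<in> S \<Longrightarrow> norm (q t) < 1"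
  shows "(\<lambda>t. connection_rhs N (m t) (n t) (q t)) holomorphic_on S"
proof -
  have nz: "1 - q t \<noteq> 0" if "t \<in> S" for t
    using q[OF that] by auto
  have "Re (1 / (1 - q t)) \<ge> 0" if "t \<in> S" for t
    using q[OF that] abs_Re_le_cmod[of "q t"] by (simp add: Re_divide)
  moreover have "Re (n t - of_nat k + 1/2) > 0" if "t \<in> S" "k < N" for t k
    using n[OF that(1)] that(2) by simp
  ultimately show ?thesis
    unfolding connection_rhs_def a_coeff_def
    by (intro holomorphic_intros holomorphic_on_remainder_integral[OF S] hol complex_nonpole m n nz) auto
qed

text \<open>Strip, half plane and disc are convex, hence connected, and in each step the variables
  still to be treated are real. The base interval |\<mu>| < 1/2 lies in the strip for every
  N.\<close>

lemma connection_formula: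
  assumes \<mu>: "\<bar>Re \<mu>\<bar> < N + 1/2" and \<nu>: "Re \<nu> > N - 1/2" and q: "norm q < 1"
  shows "connection_lhs \<mu> \<nu> q = connection_rhs N \<mu> \<nu> q"
proof -
  note hol = holomorphic_on_connection_lhs[where N = N] holomorphic_on_connection_rhs[where N = N]
  have 1: "connection_lhs \<mu> (of_real n) (of_real q) = connection_rhs N \<mu> (of_real n) (of_real q)"
    if n: "n > N - 1/2" and q: "0 < q" "q < 1" for n q
  proof (rule holomorphic_eq_from_reals[where a = "- 1/2" and b = "1/2" and z = \<mu>])
    let ?S = "{t. \<bar>Re t\<bar> < N + 1/2}"
    have eq: "?S = {t. Re t > - (N + 1/2)} \<inter> {t. Re t < N + 1/2}" by (auto simp: abs_less_iff)
    show S: "open ?S" unfolding eq by (intro open_Int open_halfspace_Re_gt open_halfspace_Re_lt)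
    show "connected ?S"
      unfolding eq by (intro convex_connected convex_Int convex_halfspace_Re_gt convex_halfspace_Re_lt)
    show "(\<lambda>\<mu>. connection_lhs \<mu> (of_real n) (of_real q)) holomorphic_on ?S"
      "(\<lambda>\<mu>. connection_rhs N \<mu> (of_real n) (of_real q)) holomorphic_on ?S"
      using n q by (intro hol S holomorphic_intros; simp)+
    fix x :: real assume "- 1/2 < x" "x < 1/2"
    then show "of_real x \<in> ?S \<and> connection_lhs (of_real x) (of_real n) (of_real q) =
        connection_rhs N (of_real x) (of_real n) (of_real q)"
      using n q by (auto intro!: connection_real simp: abs_if)
  qed (use \<mu> in auto)
  have 2: "connection_lhs \<mu> \<nu> (of_real q) = connection_rhs N \<mu> \<nu> (of_real q)" if q: "0 < q" "q < 1" for q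
  proof (rule holomorphic_eq_from_reals[where a = "N - 1/2" and b = "N + 1/2" and z = \<nu>])
    let ?S = "{t. Re t > N - 1/2}"
    show S: "open ?S" by (rule open_halfspace_Re_gt)
    show "connected ?S" by (intro convex_connected convex_halfspace_Re_gt)
    show "(\<lambda>\<nu>. connection_lhs \<mu> \<nu> (of_real q)) holomorphic_on ?S"
      "(\<lambda>\<nu>. connection_rhs N \<mu> \<nu> (of_real q)) holomorphic_on ?S"
      using \<mu> q by (intro hol S holomorphic_intros; simp)+
  qed (use \<nu> q 1 in auto)
  show ?thesis
  proof (rule holomorphic_eq_from_reals[where a = 0 and b = 1 and z = q])
    let ?S = "ball 0 1 :: complex set"
    show S: "open ?S" "connected ?S" by auto
    show "(\<lambda>q. connection_lhs \<mu> \<nu> q) holomorphic_on ?S" "(\<lambda>q. connection_rhs N \<mu> \<nu> q) holomorphic_on ?S"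
      using \<mu> \<nu> by (intro hol S holomorphic_intros; simp)+
  qed (use q 2 in auto)
qed

subsection \<open>Gauss' quadratic transformation and the analytic continuation\<close>

text \<open>Both sides are the general term of the binomial series of (1 - x)^(-B); the signs cancel
  in pairs.\<close>

lemma neg_binomial_pochhammer:
  fixes x :: "'a :: field_char_0"
  shows "(- B gchoose k) * (- x) ^ k = pochhammer B k / fact k * x ^ k"
  by (simp add: gbinomial_pochhammer power_minus[of x] mult_ac flip: power_add mult_2)

text \<open>Splitting (p)_(n+m) as (p)_n (p+n)_m and writing (-1)^(n-m) / (n-m)! through (-n)_m
  turns the sum into a terminating 2F1(-n, p+n; c; 1).\<close>

lemma quadratic_term_sum:
  fixes p c :: complex
  assumes c: "Re c > 0"
  shows "(\<Sum>m\<le>n. pochhammer p (n + m) * rGamma (c + of_nat m) * (- 1) ^ (n - m) / (fact m * fact (n - m))) =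
    pochhammer p n * pochhammer (p - c + 1) n * rGamma (c + of_nat n) / fact n"
proof -
  have nz: "pochhammer c k \<noteq> 0" for k
    using pochhammer_le_norm[of "Re c" c k] pochhammer_pos[OF c, of k] c by auto
  have r: "rGamma (c + of_nat k) = rGamma c / pochhammer c k" for k
    using nz[of k] pochhammer_rGamma[of c k] by (simp add: field_simps)
  have poch: "(- 1) ^ (n - m) / fact (n - m) = (- 1) ^ n * pochhammer (- of_nat n) m / (fact n :: complex)" if "m \<le> n" for m
  proof -
    have "pochhammer (of_nat n - of_nat m + 1 :: complex) m = fact n / fact (n - m)"
    proof -
      have "fact n = fact (n - m) * pochhammer (of_nat (n - m) + 1 :: complex) m"
        using pochhammer_product'[of "1 :: complex" "n - m" m] that by (simp add: pochhammer_fact add.commute of_nat_diff)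
      then show ?thesis using that by (simp add: of_nat_diff field_simps)
    qed
    moreover have "(- 1 :: complex) ^ n * (- 1) ^ m = (- 1) ^ (n - m)"
    proof -
      have "(- 1 :: complex) ^ n = (- 1) ^ (n - m) * (- 1) ^ m"
        using that by (simp flip: power_add)
      moreover have "(- 1 :: complex) ^ m * (- 1) ^ m = 1"
        by (simp flip: power_mult_distrib)
      ultimately show ?thesis by (simp only: mult.assoc mult_1_right)
    qed
    ultimately show ?thesis
      by (simp add: pochhammer_minus mult.assoc[symmetric])
  qed
  have "(\<Sum>m\<le>n. pochhammer p (n + m) * rGamma (c + of_nat m) * (- 1) ^ (n - m) / (fact m * fact (n - m))) =
    (\<Sum>m\<le>n. pochhammer p n * rGamma c * (- 1) ^ n / fact n *
      ((pochhammer (p + of_nat n) m * pochhammer (- of_nat n) m) / (of_nat (fact m) * pochhammer c m)))"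
  proof (rule sum.cong)
    fix m assume "m \<in> {..n}"
    then have m: "m \<le> n" by simp
    have "pochhammer p (n + m) * rGamma (c + of_nat m) * (- 1) ^ (n - m) / (fact m * fact (n - m)) =
      pochhammer p n * pochhammer (p + of_nat n) m * (rGamma c / pochhammer c m) / fact m * ((- 1) ^ (n - m) / fact (n - m))"
      by (simp add: pochhammer_product' r)
    then show "pochhammer p (n + m) * rGamma (c + of_nat m) * (- 1) ^ (n - m) / (fact m * fact (n - m)) =
      pochhammer p n * rGamma c * (- 1) ^ n / fact n *
      ((pochhammer (p + of_nat n) m * pochhammer (- of_nat n) m) / (of_nat (fact m) * pochhammer c m))"
      unfolding poch[OF m] by (simp add: mult_ac)
  qed simp
  also have "\<dots> = pochhammer p n * rGamma c * (- 1) ^ n / fact n * (pochhammer (c - (p + of_nat n)) n / pochhammer c n)"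
    unfolding sum_distrib_left[symmetric] atLeast0AtMost[symmetric]
    using c by (subst Vandermonde_pochhammer) (auto simp: complex_eq_iff)
  also have "c - (p + of_nat n) = - (p + of_nat n - c)" by simp
  \<comment> \<open>Chu-Vandermonde leaves (c-p-n)_n; reversing its factors gives (-1)^n (p-c+1)_n,
    and this sign cancels the one in front.\<close>
  also have "pochhammer (- (p + of_nat n - c)) n = (- 1) ^ n * pochhammer (p - c + 1) n"
    by (subst pochhammer_minus) simp
  finally show ?thesis by (simp add: r mult_ac flip: power_add mult_2)
qed

lemma bij_betw_diagonals: "bij_betw (\<lambda>(n, m). (m, n - m)) (SIGMA n:UNIV. {..n}) (UNIV :: (nat \<times> nat) set)"
  by (rule bij_betwI[where g = "\<lambda>(m, k). (m + k, m)"]) auto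

text \<open>
  After expanding \<open>(1 + q)\<^bsup>- 2 a - 2 m\<^esup>\<close> by the binomial series, the double series is summed along
  diagonals, where the Chu--Vandermonde identity applies. The bound \<open>q < 1/8\<close> makes the double
  series absolutely convergent, since then \<open>4 q / (1 - q)\<^sup>2 < 1\<close>.
\<close>
lemma hyp_series_quadratic_real:
  fixes a c :: complex and q :: real
  assumes c: "Re c > 0" and q: "0 < q" "q < 1/8"
  shows "hyp_series (a + 1/2) a c (of_real (4 * q / (1 + q)\<^sup>2)) =
    (1 + of_real q) powr (2 * a) * hyp_series (2 * a) (2 * a - c + 1) c (of_real q)"
proof -
  define p where "p = 2 * a"
  define P where "P = norm p + 1"
  have P: "P > 0" "norm p \<le> P" by (auto simp: P_def add_nonneg_pos)
  define F where "F = (\<lambda>(m, k). pochhammer p (2 * m) * rGamma (c + of_nat m) / fact m * of_real q ^ m *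
    (pochhammer (p + of_nat (2 * m)) k / fact k * (- of_real q) ^ k))"
  \<comment> \<open>Majorant of \<open>F\<close>. Absolute values turn (-q)^k into q^k, so its rows
    sum to powers of 1 - q instead of 1 + q; hence the ratio 4 q / (1-q)^2 below.\<close>
  define G where "G = (\<lambda>(m, k). pochhammer P (2 * m) * (norm (rGamma c) / pochhammer (Re c) m) / fact m * q ^ m *
    (pochhammer (P + of_nat (2 * m)) k / fact k * q ^ k))"
  define g where "g = (\<lambda>m. pochhammer P (2 * m) * (norm (rGamma c) / pochhammer (Re c) m) / fact m * q ^ m *
    (1 - q) powr (- (P + of_nat (2 * m))))"
  have cpos: "pochhammer (Re c) m > 0" for m using c by (rule pochhammer_pos)
  have G_nonneg: "G x \<ge> 0" for x
    using q P c
    by (auto simp: G_def case_prod_beta intro!: mult_nonneg_nonneg divide_nonneg_nonneg pochhammer_nonneg add_pos_nonneg)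
  have "G summable_on (SIGMA m:UNIV. UNIV)"
  proof (rule summable_on_SigmaI)
    fix m :: nat
    have "(\<lambda>k. (- (P + of_nat (2 * m)) gchoose k) * (- q) ^ k) sums (1 + - q) powr (- (P + of_nat (2 * m)))"
      using q by (intro gen_binomial_real) simp
    then have "(\<lambda>k. G (m, k)) sums g m"
      unfolding neg_binomial_pochhammer G_def g_def prod.case by (intro sums_mult) simp
    then show "((\<lambda>k. G (m, k)) has_sum g m) UNIV"
      by (rule sums_nonneg_imp_has_sum) (rule G_nonneg)
  next
    \<comment> \<open>Duplication gives (P)_(2m) = 4^m (P/2)_m (P/2+1/2)_m, and \<open>A\<close>
      bounds both bases.\<close>
    define A where "A = P / 2 + 1/2"
    define Q where "Q = 4 * q / (1 - q)\<^sup>2"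
    have Q: "0 \<le> Q" "Q < 1"
    proof -
      \<comment> \<open>For q < 1/8 one has 4 q < 1/2 < 49/64 \<le> (1-q)^2.\<close>
      have "(7/8)\<^sup>2 \<le> (1 - q)\<^sup>2" using q by (intro power_mono) auto
      then have "4 * q < (1 - q)\<^sup>2" using q by (simp add: power2_eq_square)
      then show "Q < 1" using q by (simp add: Q_def)
    qed (use q in \<open>simp add: Q_def\<close>)
    have A: "A > 0" using P by (simp add: A_def)
    have g_le: "norm (g m) \<le> norm (rGamma c) * (1 - q) powr (- P) *
        (pochhammer A m * pochhammer A m / (pochhammer (Re c) m * fact m) * Q ^ m)" for m
    proof -
      have "(1 - q) powr of_nat (2 * m) = (1 - q) ^ (2 * m)"
        using q by (intro powr_realpow) simp
      then have "(1 - q) powr (- (P + of_nat (2 * m))) = (1 - q) powr (- P) * (1 / (1 - q)\<^sup>2) ^ m"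
        by (simp only: minus_add_distrib powr_add powr_minus[of _ "of_nat _"])
           (simp add: power_divide power_mult inverse_eq_divide)
      moreover have "pochhammer P (2 * m) = 4 ^ m * pochhammer (P / 2) m * pochhammer A m"
        using pochhammer_double[of "P / 2" m] by (simp add: A_def power_mult)
      ultimately have "g m = norm (rGamma c) * (1 - q) powr (- P) *
        (pochhammer (P / 2) m * pochhammer A m / (pochhammer (Re c) m * fact m) * Q ^ m)"
        by (simp add: g_def Q_def power_divide power_mult_distrib mult_ac)
      moreover have "pochhammer (P / 2) m \<le> pochhammer A m"
        unfolding pochhammer_prod A_def using P by (intro prod_mono) auto
      moreover have "g m \<ge> 0"
        using q P c by (auto simp: g_def intro!: mult_nonneg_nonneg divide_nonneg_nonneg pochhammer_nonneg)
      moreover have "norm (rGamma c) * (1 - q) powr (- P) *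
          (pochhammer (P / 2) m * pochhammer A m / (pochhammer (Re c) m * fact m) * Q ^ m) \<le>
        norm (rGamma c) * (1 - q) powr (- P) *
          (pochhammer A m * pochhammer A m / (pochhammer (Re c) m * fact m) * Q ^ m)"
        using P A Q c \<open>pochhammer (P / 2) m \<le> pochhammer A m\<close>
        by (intro mult_left_mono mult_right_mono divide_right_mono mult_nonneg_nonneg pochhammer_nonneg) auto
      ultimately show ?thesis by (simp only: real_norm_def abs_of_nonneg)
    qed
    have "summable g"
    proof (rule summable_comparison_test')
      show "summable (\<lambda>m. norm (rGamma c) * (1 - q) powr (- P) *
        (pochhammer A m * pochhammer A m / (pochhammer (Re c) m * fact m) * Q ^ m))"
        using A Q c by (intro summable_mult summable_hyp_majorant)
    qed (rule g_le)
    moreover have "g m \<ge> 0" for m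
      using q P c by (auto simp: g_def intro!: mult_nonneg_nonneg divide_nonneg_nonneg pochhammer_nonneg)
    ultimately show "g summable_on UNIV" by (rule summable_nonneg_imp_summable_on)
  qed (rule G_nonneg)
  moreover have "norm (F x) \<le> G x" for x
  proof -
    obtain m k where x: "x = (m, k)" by (cases x)
    have "norm (p + of_nat (2 * m)) \<le> P + of_nat (2 * m)"
      using P norm_triangle_le[of p "of_nat (2 * m)"] by (simp add: P_def norm_mult)
    then show ?thesis
      unfolding x F_def G_def prod.case using P q c cpos[of m]
      by (auto simp only: norm_mult norm_divide norm_power norm_minus_cancel norm_of_real norm_fact abs_of_pos
            intro!: mult_mono divide_right_mono norm_rGamma_plus_of_nat_le norm_pochhammer_le mult_nonneg_nonneg
            divide_nonneg_nonneg pochhammer_nonneg zero_le_power order_refl norm_ge_zero fact_ge_zero)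
  qed
  ultimately have F_abs: "(\<lambda>x. norm (F x)) summable_on UNIV"
    by - (rule summable_on_comparison_test[of G], auto)
  then have "F summable_on UNIV" by (rule abs_summable_summable)
  then obtain S where S: "(F has_sum S) UNIV" by (auto simp: summable_on_def)
  \<comment> \<open>The k-sum in row m is (1+q)^(-p-2m). Together with (p)_(2m) = 4^m (a)_m
    (a+1/2)_m it yields a term of the series in 4 q / (1+q)^2.\<close>
  have rows: "(\<lambda>k. F (m, k)) sums ((1 + of_real q) powr (- p) *
      (pochhammer (a + 1/2) m * pochhammer a m * rGamma (c + of_nat m) / fact m * of_real (4 * q / (1 + q)\<^sup>2) ^ m))" for m
  proof -
    have "(\<lambda>k. (- (p + of_nat (2 * m)) gchoose k) * of_real q ^ k) sums (1 + of_real q) powr (- (p + of_nat (2 * m)))"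
      using q by (intro gen_binomial_complex) simp
    then have "(\<lambda>k. pochhammer (p + of_nat (2 * m)) k / fact k * (- of_real q) ^ k) sums (1 + of_real q) powr (- (p + of_nat (2 * m)))"
      using neg_binomial_pochhammer[of "p + of_nat (2 * m)" _ "- complex_of_real q"] by simp
    then have "(\<lambda>k. F (m, k)) sums (pochhammer p (2 * m) * rGamma (c + of_nat m) / fact m * of_real q ^ m *
        (1 + of_real q) powr (- (p + of_nat (2 * m))))"
      unfolding F_def prod.case by (rule sums_mult)
    also have "(1 + of_real q) powr (- (p + of_nat (2 * m))) = (1 + of_real q) powr (- p) / (1 + complex_of_real q) ^ (2 * m)"
    proof -
      have "1 + complex_of_real q \<noteq> 0" using q by (auto simp: complex_eq_iff)
      then show ?thesis
        by (simp only: minus_add_distrib powr_add powr_minus[of _ "of_nat _"] powr_nat) (simp add: field_simps)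
    qed
    also have "pochhammer p (2 * m) = 4 ^ m * pochhammer a m * pochhammer (a + 1/2) m"
      using pochhammer_double[of a m] by (simp add: p_def power_mult)
    finally show ?thesis by (simp add: power_mult_distrib power_divide mult_ac flip: power_mult)
  qed
  have "norm (complex_of_real (4 * q / (1 + q)\<^sup>2)) < 1"
  proof -
    have "(1 - q)\<^sup>2 > 0" using q by simp
    then have "4 * q < (1 + q)\<^sup>2" by (simp add: power2_eq_square algebra_simps)
    then have "\<bar>4 * q / (1 + q)\<^sup>2\<bar> < 1" using q by simp
    then show ?thesis by (simp only: norm_of_real)
  qed
  then have "(\<lambda>m. (1 + of_real q) powr (- p) * (pochhammer (a + 1/2) m * pochhammer a m * rGamma (c + of_nat m) / fact m *
       of_real (4 * q / (1 + q)\<^sup>2) ^ m)) sums ((1 + of_real q) powr (- p) * hyp_series (a + 1/2) a c (of_real (4 * q / (1 + q)\<^sup>2)))"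
    by (intro sums_mult sums_hyp_series c)
  moreover have "(\<lambda>m. (1 + of_real q) powr (- p) * (pochhammer (a + 1/2) m * pochhammer a m * rGamma (c + of_nat m) / fact m *
       of_real (4 * q / (1 + q)\<^sup>2) ^ m)) sums S"
  proof (rule has_sum_imp_sums, rule has_sum_SigmaD[where B = "\<lambda>_. UNIV" and f = F])
    show "(F has_sum S) (UNIV \<times> UNIV)" using S by simp
    fix m :: nat
    have "(\<lambda>k. norm (F (m, k))) summable_on UNIV"
    proof (subst summable_on_reindex_bij_betw[of "\<lambda>k. (m, k)" UNIV "{m} \<times> UNIV"])
      show "bij_betw (\<lambda>k. (m, k)) UNIV ({m} \<times> UNIV)" by (auto simp: bij_betw_def inj_on_def)
      show "(\<lambda>x. norm (F x)) summable_on {m} \<times> UNIV"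
        using F_abs by (rule summable_on_subset_banach) simp
    qed
    then show "((\<lambda>k. F (m, k)) has_sum ((1 + of_real q) powr (- p) * (pochhammer (a + 1/2) m * pochhammer a m *
        rGamma (c + of_nat m) / fact m * of_real (4 * q / (1 + q)\<^sup>2) ^ m))) UNIV"
      using rows[of m] by (intro norm_summable_imp_has_sum summable_on_imp_summable)
  qed
  ultimately have 1: "S = (1 + of_real q) powr (- p) * hyp_series (a + 1/2) a c (of_real (4 * q / (1 + q)\<^sup>2))"
    using sums_unique2 by blast
  \<comment> \<open>The same double sum, now along the diagonals n = m + k.\<close>
  have "((\<lambda>x. F (case x of (n, m) \<Rightarrow> (m, n - m))) has_sum S) (SIGMA n:UNIV. {..n})"
    using S has_sum_reindex_bij_betw[OF bij_betw_diagonals, of F S] by simp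
  then have "((\<lambda>n. \<Sum>m\<le>n. F (m, n - m)) has_sum S) UNIV"
    by (rule has_sum_SigmaD) (simp add: has_sum_finite)
  moreover have "(\<Sum>m\<le>n. F (m, n - m)) = pochhammer p n * pochhammer (p - c + 1) n * rGamma (c + of_nat n) / fact n * of_real q ^ n" for n
  proof -
    have "(\<Sum>m\<le>n. F (m, n - m)) = (\<Sum>m\<le>n. pochhammer p (n + m) * rGamma (c + of_nat m) * (- 1) ^ (n - m) / (fact m * fact (n - m)) * of_real q ^ n)"
    proof (rule sum.cong)
      fix m assume "m \<in> {..n}"
      then have m: "m \<le> n" by simp
      have "pochhammer p (n + m) = pochhammer p (2 * m) * pochhammer (p + of_nat (2 * m)) (n - m)"
      proof -
        have "2 * m + (n - m) = n + m" using m by simp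
        then show ?thesis using pochhammer_product'[of p "2 * m" "n - m"] by (simp only:)
      qed
      moreover have "complex_of_real q ^ n = of_real q ^ m * of_real q ^ (n - m)"
        using m by (simp flip: power_add)
      ultimately show "F (m, n - m) = pochhammer p (n + m) * rGamma (c + of_nat m) * (- 1) ^ (n - m) / (fact m * fact (n - m)) * of_real q ^ n"
        by (simp add: F_def power_minus[of "of_real q"] mult_ac)
    qed simp
    also have "\<dots> = (\<Sum>m\<le>n. pochhammer p (n + m) * rGamma (c + of_nat m) * (- 1) ^ (n - m) / (fact m * fact (n - m))) * of_real q ^ n"
      by (rule sum_distrib_right[symmetric])
    finally show ?thesis by (simp only: quadratic_term_sum[OF c])
  qed
  ultimately have "(\<lambda>n. pochhammer p n * pochhammer (p - c + 1) n * rGamma (c + of_nat n) / fact n * of_real q ^ n) sums S"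
    using has_sum_imp_sums by simp
  moreover have "(\<lambda>n. pochhammer p n * pochhammer (p - c + 1) n * rGamma (c + of_nat n) / fact n * of_real q ^ n) sums
     hyp_series p (p - c + 1) c (of_real q)"
    using q by (intro sums_hyp_series c) simp
  ultimately have 2: "S = hyp_series p (p - c + 1) c (of_real q)"
    using sums_unique2 by blast
  have "(1 + of_real q) powr p * (1 + of_real q) powr (- p) = (1 :: complex)"
  proof -
    have "1 + complex_of_real q \<noteq> 0" using q by (auto simp: complex_eq_iff)
    then show ?thesis by (simp flip: powr_add)
  qed
  then have "hyp_series (a + 1/2) a c (of_real (4 * q / (1 + q)\<^sup>2)) = (1 + of_real q) powr p * S"
    unfolding 1 mult.assoc[symmetric] by (simp only: mult_1_left)
  then show ?thesis unfolding 2 p_def .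
qed

section \<open>The continuation to the slit plane\<close>

definition slit_plane :: "complex set" where
  "slit_plane = UNIV - complex_of_real ` {1..}"

lemma slit_plane_iff: "w \<in> slit_plane \<longleftrightarrow> 1 - w \<notin> \<real>\<^sub>\<le>\<^sub>0"
proof -
  have "w \<in> complex_of_real ` {1..} \<longleftrightarrow> 1 - w \<in> \<real>\<^sub>\<le>\<^sub>0"
  proof
    assume "1 - w \<in> \<real>\<^sub>\<le>\<^sub>0"
    then show "w \<in> complex_of_real ` {1..}"
      by (intro image_eqI[of _ _ "Re w"]) (auto simp: complex_nonpos_Reals_iff complex_eq_iff)
  qed (auto simp: complex_nonpos_Reals_iff)
  then show ?thesis by (simp add: slit_plane_def)
qed

lemma slit_plane_eq: "slit_plane = (\<lambda>z. 1 - z) ` (- \<real>\<^sub>\<le>\<^sub>0)"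
proof -
  have "w \<in> (\<lambda>z. 1 - z) ` (- \<real>\<^sub>\<le>\<^sub>0)" if "1 - w \<notin> \<real>\<^sub>\<le>\<^sub>0" for w :: complex
    using that by (intro image_eqI[of _ _ "1 - w"]) auto
  then show ?thesis by (auto simp: slit_plane_iff)
qed

lemma open_slit_plane: "open slit_plane"
proof -
  have "slit_plane = (\<lambda>w. 1 - w) -` (- \<real>\<^sub>\<le>\<^sub>0)" by (auto simp: slit_plane_iff)
  moreover have "open ((\<lambda>w. 1 - w) -` (- \<real>\<^sub>\<le>\<^sub>0 :: complex set))"
    by (intro open_vimage open_Compl closed_nonpos_Reals_complex continuous_intros)
  ultimately show ?thesis by simp
qed

text \<open>The reflection z to 1 - z leads to the plane cut along the nonpositive reals, which is
  star-shaped about 1.\<close>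

lemma connected_slit_plane: "connected slit_plane"
proof -
  have "starlike (- \<real>\<^sub>\<le>\<^sub>0 :: complex set)"
    unfolding starlike_def
  proof (intro bexI ballI)
    show "(1 :: complex) \<in> - \<real>\<^sub>\<le>\<^sub>0" by simp
    fix x :: complex assume x: "x \<in> - \<real>\<^sub>\<le>\<^sub>0"
    show "closed_segment 1 x \<subseteq> - \<real>\<^sub>\<le>\<^sub>0"
    proof
      fix z assume "z \<in> closed_segment 1 x"
      then obtain u where u: "0 \<le> u" "u \<le> 1" and z: "z = (1 - u) *\<^sub>R 1 + u *\<^sub>R x"
        by (auto simp: closed_segment_def)
      have "z \<notin> \<real>\<^sub>\<le>\<^sub>0"
      proof
        assume "z \<in> \<real>\<^sub>\<le>\<^sub>0"
        then have *: "(1 - u) + u * Re x \<le> 0" "u * Im x = 0" by (auto simp: z complex_nonpos_Reals_iff)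
        have "u \<noteq> 0" using *(1) by auto
        then have "Im x = 0" "u > 0" using *(2) u by auto
        moreover have "u * Re x \<le> 0" using *(1) u by linarith
        ultimately show False using x by (auto simp: complex_nonpos_Reals_iff mult_le_0_iff)
      qed
      then show "z \<in> - \<real>\<^sub>\<le>\<^sub>0" by simp
    qed
  qed
  then show ?thesis
    unfolding slit_plane_eq by (intro connected_continuous_image starlike_imp_connected continuous_intros)
qed

lemma norm_moebius_less_1:
  assumes "Re s > 0"
  shows "norm ((1 - s) / (1 + s)) < 1"
proof -
  have "norm (1 - s) ^ 2 < norm (1 + s) ^ 2"
    unfolding cmod_power2 using assms by (simp add: power2_eq_square algebra_simps)
  then have "norm (1 - s) < norm (1 + s)" by (rule power_less_imp_less_base) simp
  then show ?thesis by (simp add: norm_divide divide_less_eq)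
qed

text \<open>The explicit continuation. With s = sqrt(1-w), the point q = (1-s)/(1+s) of the unit
  disc solves w = 4q/(1+q)^2, and (1+s)/2 = 1/(1+q); so this is the quadratic transformation solved
  for w.\<close>

definition hyp_quadratic :: "complex \<Rightarrow> complex \<Rightarrow> complex \<Rightarrow> complex" where
  "hyp_quadratic a c w = (let s = csqrt (1 - w) in
     ((1 + s) / 2) powr (- (2 * a)) * hyp_series (2 * a) (2 * a - c + 1) c ((1 - s) / (1 + s)))"

lemma Re_csqrt_pos: "z \<notin> \<real>\<^sub>\<le>\<^sub>0 \<Longrightarrow> Re (csqrt z) > 0"
proof (rule ccontr)
  assume z: "z \<notin> \<real>\<^sub>\<le>\<^sub>0" and "\<not> Re (csqrt z) > 0"
  then have "Re (csqrt z) = 0" using csqrt_principal[of z] by auto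
  then have "(csqrt z)\<^sup>2 \<in> \<real>\<^sub>\<le>\<^sub>0"
    by (simp only: complex_nonpos_Reals_iff Re_power2 Im_power2) simp
  with z show False by simp
qed

lemma holomorphic_on_hyp_quadratic:
  assumes c: "Re c > 0"
  shows "hyp_quadratic a c holomorphic_on slit_plane"
proof -
  have s: "Re (csqrt (1 - w)) > 0" if "w \<in> slit_plane" for w
    using that by (intro Re_csqrt_pos) (simp add: slit_plane_iff)
  have nz: "1 + csqrt (1 - w) \<noteq> 0" "(1 + csqrt (1 - w)) / 2 \<notin> \<real>\<^sub>\<le>\<^sub>0" if "w \<in> slit_plane" for w
  proof -
    have "1 + z \<noteq> 0 \<and> (1 + z) / 2 \<notin> \<real>\<^sub>\<le>\<^sub>0" if "Re z > 0" for z
      using that by (auto simp: complex_eq_iff complex_nonpos_Reals_iff)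
    then show "1 + csqrt (1 - w) \<noteq> 0" "(1 + csqrt (1 - w)) / 2 \<notin> \<real>\<^sub>\<le>\<^sub>0" using s[OF that] by blast+
  qed
  have hol: "(\<lambda>w. csqrt (1 - w)) holomorphic_on slit_plane"
    by (intro holomorphic_intros) (auto simp: slit_plane_iff)
  have "(\<lambda>w. ((1 + csqrt (1 - w)) / 2) powr (- (2 * a))) holomorphic_on slit_plane"
    by (intro holomorphic_on_powr holomorphic_on_divide holomorphic_on_add holomorphic_on_const hol nz) auto
  moreover have "(\<lambda>w. hyp_series (2 * a) (2 * a - c + 1) c ((1 - csqrt (1 - w)) / (1 + csqrt (1 - w)))) holomorphic_on slit_plane"
    using c s by (intro holomorphic_on_hyp_series[OF open_slit_plane] norm_moebius_less_1
      holomorphic_on_divide holomorphic_on_add holomorphic_on_diff holomorphic_on_const hol nz)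
  ultimately show ?thesis
    unfolding hyp_quadratic_def[abs_def] Let_def by (rule holomorphic_on_mult)
qed

lemma moebius_square:
  assumes q: "norm q < 1"
  shows "1 + q \<noteq> 0" "Re ((1 - q) / (1 + q)) > 0" "1 - 4 * q / (1 + q)\<^sup>2 = ((1 - q) / (1 + q))\<^sup>2"
proof -
  show nz: "1 + q \<noteq> 0" using q by (metis add.commute add_eq_0_iff norm_minus_cancel norm_one less_irrefl)
  have "norm q ^ 2 < 1" using q by (simp add: power_less_one_iff abs_square_less_1)
  then have "(Re q)\<^sup>2 + (Im q)\<^sup>2 < 1" by (simp add: cmod_power2)
  moreover have "Re ((1 - q) / (1 + q)) = (1 - ((Re q)\<^sup>2 + (Im q)\<^sup>2)) / (norm (1 + q))\<^sup>2"
    unfolding cmod_power2 by (simp add: Re_divide power2_eq_square algebra_simps)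
  ultimately show "Re ((1 - q) / (1 + q)) > 0"
    using nz by simp
  have "1 - 4 * q / (1 + q)\<^sup>2 = ((1 + q)\<^sup>2 - 4 * q) / (1 + q)\<^sup>2"
    using nz by (simp add: diff_divide_distrib)
  also have "(1 + q)\<^sup>2 - 4 * q = (1 - q)\<^sup>2"
    by (simp add: power2_eq_square algebra_simps)
  finally show "1 - 4 * q / (1 + q)\<^sup>2 = ((1 - q) / (1 + q))\<^sup>2" by (simp add: power_divide)
qed

lemma square_notin_nonpos_Reals:
  assumes "Re s > 0"
  shows "s\<^sup>2 \<notin> \<real>\<^sub>\<le>\<^sub>0"
proof
  assume "s\<^sup>2 \<in> \<real>\<^sub>\<le>\<^sub>0"
  then have *: "(Re s)\<^sup>2 - (Im s)\<^sup>2 \<le> 0" "2 * Re s * Im s = 0"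
    by (simp_all only: complex_nonpos_Reals_iff Re_power2 Im_power2)
  then have "(Re s)\<^sup>2 \<le> 0" using assms by simp
  then show False using assms by simp
qed

text \<open>For |q| < 1 the number (1-q)/(1+q) has positive real part, so it is the root of 1 - w
  that \<open>csqrt\<close> selects.\<close>

lemma hyp_quadratic_moebius:
  assumes q: "norm q < 1"
  shows "hyp_quadratic a c (4 * q / (1 + q)\<^sup>2) = (1 + q) powr (2 * a) * hyp_series (2 * a) (2 * a - c + 1) c q"
proof -
  define s where "s = (1 - q) / (1 + q)"
  have nz: "1 + q \<noteq> 0" and "Re s > 0" and "1 - 4 * q / (1 + q)\<^sup>2 = s\<^sup>2"
    using moebius_square[OF q] by (simp_all add: s_def)
  then have s: "csqrt (1 - 4 * q / (1 + q)\<^sup>2) = s"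
    using \<open>Re s > 0\<close> by (simp add: csqrt_square)
  have e: "1 + s = 2 * inverse (1 + q)" "1 - s = q * (2 * inverse (1 + q))"
    using nz by (simp_all add: s_def field_simps)
  have "(1 + s) / 2 = inverse (1 + q)" by (simp only: e) simp
  moreover have "(1 - s) / (1 + s) = q" using nz by (simp only: e) simp
  moreover have "inverse (1 + q) powr (- (2 * a)) = (1 + q) powr (2 * a)"
  proof -
    have "1 + q \<notin> \<real>\<^sub>\<le>\<^sub>0" using q abs_Re_le_cmod[of q] by (auto simp: complex_nonpos_Reals_iff)
    then show ?thesis using nz by (simp add: powr_def Ln_inverse)
  qed
  ultimately show ?thesis by (simp add: hyp_quadratic_def s)
qed

lemma hyp_quadratic_series:
  assumes c: "Re c > 0" and w: "norm w < 1"
  shows "hyp_quadratic a c w = hyp_series (a + 1/2) a c w"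
proof (rule holomorphic_eq_from_reals[where a = 0 and b = "1/4" and S = "ball 0 1" and z = w])
  have sub: "ball 0 1 \<subseteq> slit_plane"
  proof
    fix w :: complex assume "w \<in> ball 0 1"
    then show "w \<in> slit_plane" using abs_Re_le_cmod[of w] by (auto simp: slit_plane_iff complex_nonpos_Reals_iff)
  qed
  show "hyp_quadratic a c holomorphic_on ball 0 1"
    using holomorphic_on_hyp_quadratic[OF c] sub by (rule holomorphic_on_subset)
  show "hyp_series (a + 1/2) a c holomorphic_on ball 0 1"
    using c by (intro holomorphic_on_hyp_series[where q = "\<lambda>t. t"] holomorphic_intros) auto
  fix x :: real assume x: "0 < x" "x < 1/4"
  define s where "s = sqrt (1 - x)"
  define q where "q = (1 - s) / (1 + s)"
  \<comment> \<open>The condition q < 1/8 amounts to s > 7/9, and x < 1/4 gives s^2 > 3/4 >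
    (7/9)^2.\<close>
  have s: "s > 7/9" "s < 1" "s\<^sup>2 = 1 - x"
  proof -
    have "sqrt ((7/9)\<^sup>2) < sqrt (1 - x)" using x by (intro real_sqrt_less_mono) (simp add: power2_eq_square)
    then show "s > 7/9" by (simp add: s_def)
    show "s < 1" "s\<^sup>2 = 1 - x" using x by (auto simp: s_def)
  qed
  have q: "0 < q" "q < 1/8" using s by (auto simp: q_def field_simps)
  have xq: "x = 4 * q / (1 + q)\<^sup>2"
  proof -
    have "1 + q = 2 / (1 + s)" using s by (simp add: q_def field_simps)
    then have "4 * q / (1 + q)\<^sup>2 = (1 - s) * (1 + s)" using s by (simp add: q_def power2_eq_square)
    also have "\<dots> = x" using s(3) by (simp add: power2_eq_square algebra_simps)
    finally show ?thesis ..
  qed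
  have "hyp_quadratic a c (of_real x) = hyp_series (a + 1/2) a c (of_real x)"
    using hyp_quadratic_moebius[of "of_real q" a c] hyp_series_quadratic_real[OF c q, of a] q
    by (simp add: xq)
  then show "complex_of_real x \<in> ball 0 1 \<and> hyp_quadratic a c (of_real x) = hyp_series (a + 1/2) a c (of_real x)"
    using x by simp
qed (use w in auto)

text \<open>\<open>hyp_quadratic\<close> witnesses that the choice is meaningful; whatever function
  is chosen agrees with it on (0, 1), hence on the connected slit plane.\<close>

lemma hyp2F1_reg_eq_hyp_quadratic:
  assumes c: "Re c > 0" and w: "w \<in> slit_plane"
  shows "hyp2F1_reg (a + 1/2) a c w = hyp_quadratic a c w"
proof -
  let ?P = "\<lambda>f. f holomorphic_on slit_plane \<and> (\<forall>w. norm w < 1 \<longrightarrow> f w = hyp_series (a + 1/2) a c w)"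
  have ex: "?P (hyp_quadratic a c)"
    using holomorphic_on_hyp_quadratic[OF c] hyp_quadratic_series[OF c] by blast
  have "hyp2F1_reg (a + 1/2) a c = (SOME f. ?P f)"
    by (simp add: hyp2F1_reg_def slit_plane_def hyp_series_def)
  then have P: "?P (hyp2F1_reg (a + 1/2) a c)"
    using someI[of ?P, OF ex] by simp
  show ?thesis
  proof (rule holomorphic_eq_from_reals[where a = 0 and b = 1 and z = w, OF _ _ open_slit_plane connected_slit_plane])
    fix x :: real assume "0 < x" "x < 1"
    then show "of_real x \<in> slit_plane \<and> hyp2F1_reg (a + 1/2) a c (of_real x) = hyp_quadratic a c (of_real x)"
      using P ex by (auto simp: slit_plane_iff complex_nonpos_Reals_iff)
  qed (use P ex w in auto)
qed

subsection \<open>Branches of the logarithm on the domain of the parameter\<close>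

lemma open_D1: "open D1" and connected_D1: "connected D1"
proof -
  have eq: "D1 = {\<xi>. Re \<xi> > 0} \<inter> ({\<xi>. Im \<xi> > - pi} \<inter> {\<xi>. Im \<xi> < pi})"
    by (auto simp: D1_def abs_less_iff)
  show "open D1"
    unfolding eq by (intro open_Int open_halfspace_Re_gt open_halfspace_Im_gt open_halfspace_Im_lt)
  show "connected D1"
    unfolding eq by (intro convex_connected convex_Int convex_halfspace_Re_gt convex_halfspace_Im_gt convex_halfspace_Im_lt)
qed

lemma D1_eq_from_reals:
  assumes "f holomorphic_on D1" "g holomorphic_on D1"
    and eq: "\<And>x :: real. x > 0 \<Longrightarrow> f (of_real x) = g (of_real x)" and \<xi>: "\<xi> \<in> D1"
  shows "f \<xi> = g \<xi>"
  by (rule holomorphic_eq_from_reals[where a = 0 and b = 1 and z = \<xi>, OF assms(1,2) open_D1 connected_D1])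
     (use eq \<xi> in \<open>auto simp: D1_def\<close>)

lemma norm_exp_D1: "\<xi> \<in> D1 \<Longrightarrow> norm (exp (- (2 * \<xi>))) < 1"
  by (simp add: D1_def)

lemma sin_Im_D1: "\<xi> \<in> D1 \<Longrightarrow> sin (Im \<xi>) = 0 \<Longrightarrow> Im \<xi> = 0"
  unfolding D1_def using sin_eq_0_pi[of "Im \<xi>"] by auto

text \<open>On \<open>D1\<close> the value cosh \<xi> is real only for real \<xi>, where it exceeds
  1. The cases t = -1, 0, 1 serve the three logarithms below.\<close>

lemma cosh_D1:
  assumes \<xi>: "\<xi> \<in> D1" and t: "t \<ge> -1"
  shows "cosh \<xi> + of_real t \<notin> \<real>\<^sub>\<le>\<^sub>0"
proof
  assume *: "cosh \<xi> + of_real t \<in> \<real>\<^sub>\<le>\<^sub>0"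
  have x: "Re \<xi> > 0" using \<xi> by (simp add: D1_def)
  have R: "Re (cosh \<xi>) = cosh (Re \<xi>) * cos (Im \<xi>)" and I: "Im (cosh \<xi>) = sinh (Re \<xi>) * sin (Im \<xi>)"
    by (simp_all add: sinh_field_def cosh_field_def Re_exp Im_exp field_simps)
  have "sinh (Re \<xi>) * sin (Im \<xi>) = 0" using * I by (simp add: complex_nonpos_Reals_iff)
  then have "Im \<xi> = 0" using x sin_Im_D1[OF \<xi>] by auto
  then have "cosh (Re \<xi>) + t \<le> 0" using * R by (simp add: complex_nonpos_Reals_iff)
  moreover have "cosh (Re \<xi>) > 1" using x cosh_real_strict_mono[of 0 "Re \<xi>"] by simp
  ultimately show False using t by simp
qed

lemma sinh_D1:
  assumes \<xi>: "\<xi> \<in> D1"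
  shows "sinh \<xi> \<notin> \<real>\<^sub>\<le>\<^sub>0"
proof
  assume *: "sinh \<xi> \<in> \<real>\<^sub>\<le>\<^sub>0"
  have x: "Re \<xi> > 0" using \<xi> by (simp add: D1_def)
  have R: "Re (sinh \<xi>) = sinh (Re \<xi>) * cos (Im \<xi>)" and I: "Im (sinh \<xi>) = cosh (Re \<xi>) * sin (Im \<xi>)"
    by (simp_all add: sinh_field_def cosh_field_def Re_exp Im_exp field_simps)
  have "cosh (Re \<xi>) * sin (Im \<xi>) = 0" using * I by (simp add: complex_nonpos_Reals_iff)
  then have "Im \<xi> = 0" using x sin_Im_D1[OF \<xi>] by auto
  then have "sinh (Re \<xi>) \<le> 0" using * R by (simp add: complex_nonpos_Reals_iff)
  then show False using x by simp
qed

lemma one_pm_nonpos: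
  fixes q :: complex
  assumes "norm q < 1"
  shows "1 + q \<notin> \<real>\<^sub>\<le>\<^sub>0" "1 - q \<notin> \<real>\<^sub>\<le>\<^sub>0"
  using assms abs_Re_le_cmod[of q] by (auto simp: complex_nonpos_Reals_iff)

text \<open>Both principal logarithms stay off the cut on the connected set \<open>D1\<close>, so
  the real identity extends. This settles the branches: the powers in \<open>legendre_Q\<close>
  become exponentials in \<xi> and logarithms of 1 \<plusminus> q.\<close>

lemma Ln_cosh_D1:
  assumes "\<xi> \<in> D1"
  shows "Ln (cosh \<xi>) = \<xi> + Ln (1 + exp (- (2 * \<xi>))) - of_real (ln 2)"
proof (rule D1_eq_from_reals[OF _ _ _ assms])
  show "(\<lambda>\<xi>. Ln (cosh \<xi>)) holomorphic_on D1"
    using cosh_D1[of _ 0] by (auto intro!: holomorphic_intros simp: cosh_field_def)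
  show "(\<lambda>\<xi>. \<xi> + Ln (1 + exp (- (2 * \<xi>))) - of_real (ln 2)) holomorphic_on D1"
    by (intro holomorphic_intros one_pm_nonpos norm_exp_D1)
  fix x :: real assume x: "x > 0"
  have c: "cosh (complex_of_real x) = of_real (cosh x)"
    by (simp add: cosh_field_def exp_of_real flip: of_real_minus)
  have e: "1 + exp (- (2 * complex_of_real x)) = of_real (1 + exp (- (2 * x)))"
    by (simp flip: exp_of_real)
  have "cosh x = exp x * (1 + exp (- (2 * x))) / 2"
    by (simp add: cosh_field_def algebra_simps flip: exp_add)
  moreover have "ln (exp x * E / 2) = x + ln E - ln 2" if "E > 0" for E :: real
    using that by (simp add: ln_div ln_mult)
  ultimately have "ln (cosh x) = x + ln (1 + exp (- (2 * x))) - ln 2"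
    by (simp only: add_pos_pos zero_less_one exp_gt_zero)
  moreover have "1 + exp (- (2 * x)) > 0" by (simp add: add_pos_pos)
  ultimately show "Ln (cosh (complex_of_real x)) = of_real x + Ln (1 + exp (- (2 * of_real x))) - of_real (ln 2)"
    unfolding c e by (subst (1 2) Ln_of_real) auto
qed

lemma Ln_sinh_D1:
  assumes "\<xi> \<in> D1"
  shows "Ln (sinh \<xi>) = \<xi> + Ln (1 - exp (- (2 * \<xi>))) - of_real (ln 2)"
proof (rule D1_eq_from_reals[OF _ _ _ assms])
  show "(\<lambda>\<xi>. Ln (sinh \<xi>)) holomorphic_on D1"
    using sinh_D1 by (auto intro!: holomorphic_intros simp: sinh_field_def)
  show "(\<lambda>\<xi>. \<xi> + Ln (1 - exp (- (2 * \<xi>))) - of_real (ln 2)) holomorphic_on D1"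
    by (intro holomorphic_intros one_pm_nonpos norm_exp_D1)
  fix x :: real assume x: "x > 0"
  have c: "sinh (complex_of_real x) = of_real (sinh x)"
    by (simp add: sinh_field_def exp_of_real flip: of_real_minus)
  have e: "1 - exp (- (2 * complex_of_real x)) = of_real (1 - exp (- (2 * x)))"
    by (simp flip: exp_of_real)
  have pos: "1 - exp (- (2 * x)) > 0" "sinh x > 0" using x by auto
  have "sinh x = exp x * (1 - exp (- (2 * x))) / 2"
    by (simp add: sinh_field_def algebra_simps flip: exp_add)
  moreover have "ln (exp x * E / 2) = x + ln E - ln 2" if "E > 0" for E :: real
    using that by (simp add: ln_div ln_mult)
  ultimately have "ln (sinh x) = x + ln (1 - exp (- (2 * x))) - ln 2"
    using pos(1) by (simp only:)
  then show "Ln (sinh (complex_of_real x)) = of_real x + Ln (1 - exp (- (2 * of_real x))) - of_real (ln 2)"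
    unfolding c e using pos by (subst (1 2) Ln_of_real) auto
qed

text \<open>A sum of logarithms is used because sinh^2 takes negative values on \<open>D1\<close>,
  for instance when Im \<xi> = pi/2, and its principal logarithm jumps there.\<close>

lemma Ln_cosh_pm1_D1:
  assumes "\<xi> \<in> D1"
  shows "Ln (cosh \<xi> - 1) + Ln (cosh \<xi> + 1) = 2 * Ln (sinh \<xi>)"
proof (rule D1_eq_from_reals[OF _ _ _ assms])
  show "(\<lambda>\<xi>. Ln (cosh \<xi> - 1) + Ln (cosh \<xi> + 1)) holomorphic_on D1"
    using cosh_D1[of _ 1] cosh_D1[of _ "-1"] by (auto intro!: holomorphic_intros simp: cosh_field_def)
  show "(\<lambda>\<xi>. 2 * Ln (sinh \<xi>)) holomorphic_on D1"
    using sinh_D1 by (auto intro!: holomorphic_intros simp: sinh_field_def)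
  fix x :: real assume x: "x > 0"
  have s: "sinh (complex_of_real x) = of_real (sinh x)" and c: "cosh (complex_of_real x) = of_real (cosh x)"
    by (simp_all add: sinh_field_def cosh_field_def exp_of_real flip: of_real_minus)
  have pos: "cosh x > 1" "sinh x > 0" using x cosh_real_strict_mono[of 0 x] by auto
  have "ln (cosh x - 1) + ln (cosh x + 1) = ln ((cosh x - 1) * (cosh x + 1))"
    using pos by (simp add: ln_mult)
  also have "(cosh x - 1) * (cosh x + 1) = (sinh x)\<^sup>2"
    using cosh_square_eq[of x] by (simp add: power2_eq_square algebra_simps)
  also have "ln ((sinh x)\<^sup>2) = 2 * ln (sinh x)" using pos by (simp add: ln_realpow)
  finally have "ln (cosh x - 1) + ln (cosh x + 1) = 2 * ln (sinh x)" .
  moreover have "complex_of_real (cosh x) - 1 = of_real (cosh x - 1)" "complex_of_real (cosh x) + 1 = of_real (cosh x + 1)"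
    by simp_all
  moreover have "Ln (of_real (cosh x - 1)) = complex_of_real (ln (cosh x - 1))"
    "Ln (of_real (cosh x + 1)) = complex_of_real (ln (cosh x + 1))" "Ln (of_real (sinh x)) = complex_of_real (ln (sinh x))"
    using pos by (intro Ln_of_real; simp)+
  ultimately show "Ln (cosh (complex_of_real x) - 1) + Ln (cosh (of_real x) + 1) = 2 * Ln (sinh (of_real x))"
    unfolding s c by (simp only:) (simp flip: of_real_add)
qed

lemma csqrt_sinh_D1:
  assumes \<xi>: "\<xi> \<in> D1"
  shows "csqrt (of_real pi / (2 * sinh \<xi>)) = of_real (sqrt pi) * exp (- (\<xi> + Ln (1 - exp (- (2 * \<xi>)))) / 2)"
proof (rule csqrt_unique)
  define W where "W = \<xi> + Ln (1 - exp (- (2 * \<xi>)))"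
  have nz: "sinh \<xi> \<noteq> 0" using sinh_D1[OF \<xi>] by auto
  have W: "W = Ln (sinh \<xi>) + of_real (ln 2)" using Ln_sinh_D1[OF \<xi>] by (simp add: W_def)
  have "exp W = 2 * sinh \<xi>"
    using nz by (simp add: W exp_add exp_of_real)
  moreover have "(exp (- W / 2))\<^sup>2 = inverse (exp W)"
    by (subst exp_double[symmetric]) (simp add: exp_minus)
  moreover have "(complex_of_real (sqrt pi))\<^sup>2 = of_real pi"
    by (simp flip: of_real_power)
  ultimately have "(of_real (sqrt pi) * exp (- W / 2))\<^sup>2 = of_real pi * inverse (2 * sinh \<xi>)"
    by (simp only: power_mult_distrib)
  then show "(of_real (sqrt pi) * exp (- (\<xi> + Ln (1 - exp (- (2 * \<xi>)))) / 2))\<^sup>2 = of_real pi / (2 * sinh \<xi>)"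
    by (simp only: W_def divide_inverse)
  \<comment> \<open>|Im W| < pi puts exp (- W / 2) in the right half plane, which singles out the
    principal root.\<close>
  have "Im W = Im (Ln (sinh \<xi>))" by (simp add: W)
  moreover have "\<bar>Im (Ln (sinh \<xi>))\<bar> < pi"
    using Im_Ln_less_pi[OF sinh_D1[OF \<xi>]] mpi_less_Im_Ln[OF nz] by (simp add: abs_less_iff)
  ultimately have "Im W < pi" "Im W > - pi" by (simp_all add: abs_less_iff)
  then have "cos (Im W / 2) > 0" by (intro cos_gt_zero_pi) auto
  then have "Re (of_real (sqrt pi) * exp (- W / 2)) > 0"
    by (simp add: Re_exp)
  then show "0 < Re (of_real (sqrt pi) * exp (- (\<xi> + Ln (1 - exp (- (2 * \<xi>)))) / 2)) \<or>
    Re (of_real (sqrt pi) * exp (- (\<xi> + Ln (1 - exp (- (2 * \<xi>)))) / 2)) = 0 \<and>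
    0 \<le> Im (of_real (sqrt pi) * exp (- (\<xi> + Ln (1 - exp (- (2 * \<xi>)))) / 2))"
    unfolding W_def by blast
qed

text \<open>With q = exp (-2 \<xi>), cosh \<xi> = exp \<xi> (1+q) / 2 turns 1 / cosh^2 \<xi> into
  4q/(1+q)^2; and 2a = \<nu>+\<mu>+1, c = \<nu>+3/2 give 2a - c + 1 = \<mu>+1/2.\<close>

lemma hyp2F1_reg_cosh:
  assumes \<xi>: "\<xi> \<in> D1" and \<nu>: "Re \<nu> > - 3/2"
  shows "hyp2F1_reg ((\<nu> + \<mu> + 2) / 2) ((\<nu> + \<mu> + 1) / 2) (\<nu> + 3/2) (1 / (cosh \<xi>)\<^sup>2) =
    (1 + exp (- (2 * \<xi>))) powr (\<nu> + \<mu> + 1) * hyp_series (\<nu> + \<mu> + 1) (\<mu> + 1/2) (\<nu> + 3/2) (exp (- (2 * \<xi>)))"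
proof -
  define q where "q = exp (- (2 * \<xi>))"
  define a where "a = (\<nu> + \<mu> + 1) / 2"
  have q: "norm q < 1" unfolding q_def by (rule norm_exp_D1[OF \<xi>])
  have "cosh \<xi> = exp \<xi> * (1 + q) / 2"
    by (simp add: q_def cosh_field_def algebra_simps flip: exp_add)
  then have "(cosh \<xi>)\<^sup>2 = exp (2 * \<xi>) * (1 + q)\<^sup>2 / 4"
    by (simp only: power_divide power_mult_distrib exp_double) simp
  then have "1 / (cosh \<xi>)\<^sup>2 = 4 * inverse (exp (2 * \<xi>)) / (1 + q)\<^sup>2"
    by (simp only:) (simp add: inverse_eq_divide)
  moreover have "inverse (exp (2 * \<xi>)) = q" by (simp add: q_def exp_minus)
  ultimately have w: "1 / (cosh \<xi>)\<^sup>2 = 4 * q / (1 + q)\<^sup>2"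
    by (simp only:)
  have "1 / (cosh \<xi>)\<^sup>2 \<in> slit_plane"
    unfolding slit_plane_iff w moebius_square(3)[OF q]
    by (intro square_notin_nonpos_Reals moebius_square[OF q])
  then have "hyp2F1_reg (a + 1/2) a (\<nu> + 3/2) (1 / (cosh \<xi>)\<^sup>2) = hyp_quadratic a (\<nu> + 3/2) (1 / (cosh \<xi>)\<^sup>2)"
    using \<nu> by (intro hyp2F1_reg_eq_hyp_quadratic) auto
  also have "\<dots> = (1 + q) powr (2 * a) * hyp_series (2 * a) (2 * a - (\<nu> + 3/2) + 1) (\<nu> + 3/2) q"
    unfolding w by (rule hyp_quadratic_moebius[OF q])
  also have "2 * a = \<nu> + \<mu> + 1" by (simp add: a_def)
  also have "\<nu> + \<mu> + 1 - (\<nu> + 3/2) + 1 = \<mu> + 1/2" by simp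
  finally show ?thesis by (simp add: a_def q_def add_divide_distrib add_ac)
qed

subsection \<open>The Legendre function of the second kind\<close>

lemma legendre_Q_cosh:
  assumes \<xi>: "\<xi> \<in> D1" and \<nu>: "Re \<nu> > - 3/2" and nm: "Re (\<nu> - \<mu> + 1) > 0"
  shows "exp (- (of_real pi * \<i> * \<mu>)) * legendre_Q \<nu> \<mu> (cosh \<xi>) =
    csqrt (of_real pi / (2 * sinh \<xi>)) * exp (- ((\<nu> + 1/2) * \<xi>)) / Gamma (\<nu> - \<mu> + 1) *
      connection_lhs \<mu> \<nu> (exp (- (2 * \<xi>)))"
proof -
  define q where "q = exp (- (2 * \<xi>))"
  define L M where "L = Ln (1 - q)" and "M = Ln (1 + q)"
  define l where "l = complex_of_real (ln 2)"
  define H where "H = hyp_series (\<nu> + \<mu> + 1) (\<mu> + 1/2) (\<nu> + 3/2) q"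
  define s where "s = complex_of_real (sqrt pi)"
  have q: "norm q < 1" unfolding q_def by (rule norm_exp_D1[OF \<xi>])
  have nz: "1 + q \<noteq> 0" "1 - q \<noteq> 0" using one_pm_nonpos[OF q] by auto
  have G: "Gamma (\<nu> - \<mu> + 1) \<noteq> 0"
    using complex_nonpole[OF nm] by (simp add: Gamma_eq_zero_iff)
  have c: "cosh \<xi> \<noteq> 0" "cosh \<xi> - 1 \<noteq> 0" "cosh \<xi> + 1 \<noteq> 0"
    using cosh_D1[OF \<xi>, of 0] cosh_D1[OF \<xi>, of "-1"] cosh_D1[OF \<xi>, of 1] by auto
  have p1: "(cosh \<xi> - 1) powr (\<mu> / 2) * (cosh \<xi> + 1) powr (\<mu> / 2) = exp (\<mu> * (\<xi> + L - l))"
  proof -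
    have "(cosh \<xi> - 1) powr (\<mu> / 2) * (cosh \<xi> + 1) powr (\<mu> / 2) =
        exp (\<mu> / 2 * (Ln (cosh \<xi> - 1) + Ln (cosh \<xi> + 1)))"
      using c by (simp add: powr_def ring_distribs flip: exp_add)
    also have "\<mu> / 2 * (Ln (cosh \<xi> - 1) + Ln (cosh \<xi> + 1)) = \<mu> * (\<xi> + L - l)"
      unfolding Ln_cosh_pm1_D1[OF \<xi>] Ln_sinh_D1[OF \<xi>] by (simp add: L_def l_def q_def)
    finally show ?thesis .
  qed
  have p2: "cosh \<xi> powr (\<nu> + \<mu> + 1) = exp ((\<nu> + \<mu> + 1) * (\<xi> + M - l))"
    using c Ln_cosh_D1[OF \<xi>] by (simp add: powr_def M_def l_def q_def)
  have p3: "2 powr (\<nu> + 1) = exp ((\<nu> + 1) * l)"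
    using Ln_of_real[of 2] by (simp add: powr_def l_def)
  have p4: "(1 + q) powr (\<nu> + \<mu> + 1) = exp ((\<nu> + \<mu> + 1) * M)"
    using nz by (simp add: powr_def M_def)
  have p5: "(1 - q) powr (\<mu> + 1/2) = exp ((\<mu> + 1/2) * L)"
    using nz by (simp add: powr_def L_def)
  have F: "hyp2F1_reg ((\<nu> + \<mu> + 2) / 2) ((\<nu> + \<mu> + 1) / 2) (\<nu> + 3/2) (1 / (cosh \<xi>)\<^sup>2) = exp ((\<nu> + \<mu> + 1) * M) * H"
    using hyp2F1_reg_cosh[OF \<xi> \<nu>, of \<mu>] by (simp only: H_def p4[symmetric] q_def)
  have "exp (- (of_real pi * \<i> * \<mu>)) * legendre_Q \<nu> \<mu> (cosh \<xi>) =
      s * Gamma (\<nu> + \<mu> + 1) * exp (\<mu> * (\<xi> + L - l)) / (exp ((\<nu> + 1) * l) * exp ((\<nu> + \<mu> + 1) * (\<xi> + M - l))) *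
      (exp ((\<nu> + \<mu> + 1) * M) * H)"
    unfolding legendre_Q_def F p1 p2 p3 s_def by (simp add: exp_minus)
  also have "\<dots> = s * Gamma (\<nu> + \<mu> + 1) * H *
     (exp (\<mu> * (\<xi> + L - l)) * exp ((\<nu> + \<mu> + 1) * M) / exp ((\<nu> + 1) * l + (\<nu> + \<mu> + 1) * (\<xi> + M - l)))"
    by (simp add: exp_add)
  \<comment> \<open>The logarithm \<open>M\<close> of 1 + q and all multiples of ln 2
    cancel.\<close>
  also have "exp (\<mu> * (\<xi> + L - l)) * exp ((\<nu> + \<mu> + 1) * M) / exp ((\<nu> + 1) * l + (\<nu> + \<mu> + 1) * (\<xi> + M - l)) =
     exp (\<mu> * L - (\<nu> + 1) * \<xi>)"
    by (simp add: algebra_simps flip: exp_add exp_diff)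
  \<comment> \<open>Splits off -(\<xi>+L)/2 for the square root and (\<mu>+1/2) L for the power of 1
    - q in \<open>connection_lhs\<close>.\<close>
  also have "exp (\<mu> * L - (\<nu> + 1) * \<xi>) = exp (- (\<xi> + L) / 2) * exp (- ((\<nu> + 1/2) * \<xi>)) * exp ((\<mu> + 1/2) * L)"
  proof -
    have "- (\<xi> + L) / 2 = - (\<xi> / 2) - L / 2" by (simp add: diff_divide_distrib)
    then have "\<mu> * L - (\<nu> + 1) * \<xi> = - (\<xi> + L) / 2 + - ((\<nu> + 1/2) * \<xi>) + (\<mu> + 1/2) * L"
      by (simp only:) (simp add: algebra_simps)
    then show ?thesis by (simp only: exp_add)
  qed
  also have "s * Gamma (\<nu> + \<mu> + 1) * H * (exp (- (\<xi> + L) / 2) * exp (- ((\<nu> + 1/2) * \<xi>)) * exp ((\<mu> + 1/2) * L)) =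
     (s * exp (- (\<xi> + L) / 2)) * exp (- ((\<nu> + 1/2) * \<xi>)) / Gamma (\<nu> - \<mu> + 1) *
     (Gamma (\<nu> - \<mu> + 1) * Gamma (\<nu> + \<mu> + 1) * exp ((\<mu> + 1/2) * L) * H)"
    using G by simp
  also have "s * exp (- (\<xi> + L) / 2) = csqrt (of_real pi / (2 * sinh \<xi>))"
    unfolding csqrt_sinh_D1[OF \<xi>] s_def L_def q_def ..
  also have "Gamma (\<nu> - \<mu> + 1) * Gamma (\<nu> + \<mu> + 1) * exp ((\<mu> + 1/2) * L) * H = connection_lhs \<mu> \<nu> q"
    by (simp add: connection_lhs_def H_def p5)
  finally show ?thesis by (simp only: q_def)
qed

section \<open>The limiting coefficient and the sign of the remainder\<close>

lemma a_coeff_eq_Gamma: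
  fixes x :: real
  assumes "\<bar>x\<bar> < N + 1/2"
  shows "a_coeff N x = (- 1) ^ N * cos (pi * x) * (Gamma (N + 1/2 - x) * Gamma (N + 1/2 + x) / (pi * 2 ^ N * fact N))"
proof -
  have "a_coeff N x = cos (pi * x) / pi * (Gamma (N + 1/2 - x) * Gamma (N + 1/2 + x)) / ((- 2) ^ N * fact N)"
    unfolding a_coeff_pochhammer pochhammer_half_reflection_real[OF assms] ..
  also have "(- 2 :: real) ^ N = (- 1) ^ N * 2 ^ N" by (rule power_minus)
  finally show ?thesis by (cases "even N") (simp_all add: mult_ac)
qed

text \<open>The cosine is an explicit factor of a_N; what remains is positive and continuous on |x|
  < N + 1/2, also at the zeros of the cosine.\<close>

lemma a_coeff_over_cos:
  fixes x :: real
  assumes "\<bar>x\<bar> < N + 1/2" "cos (pi * x) \<noteq> 0"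
  shows "\<bar>a_coeff N x\<bar> / \<bar>cos (pi * x)\<bar> = Gamma (N + 1/2 - x) * Gamma (N + 1/2 + x) / (pi * 2 ^ N * fact N)"
proof -
  have "Gamma (N + 1/2 - x) * Gamma (N + 1/2 + x) / (pi * 2 ^ N * fact N) \<ge> 0"
    using assms by (auto intro!: divide_nonneg_nonneg mult_nonneg_nonneg Gamma_real_pos[THEN less_imp_le])
  then show ?thesis
    using assms by (simp only: a_coeff_eq_Gamma[OF assms(1)] abs_mult power_abs) simp
qed

lemma cos_pi_eq_0_iff: "cos (pi * x) = 0 \<longleftrightarrow> (\<exists>k :: int. odd k \<and> 2 * x = of_int k)"
  unfolding cos_zero_iff_int by (intro ex_cong1) (auto simp: field_simps)

text \<open>The zeros of cos (pi x) in this range are removable: at all other points nearby the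
  quotient equals the continuous right-hand side.\<close>

lemma limiting_coefficient:
  fixes x :: real
  assumes x: "\<bar>x\<bar> < N + 1/2"
  shows "(if \<exists>k :: int. odd k \<and> 2 * x = of_int k
       then Lim (at x) (\<lambda>x. \<bar>a_coeff N x\<bar> / \<bar>cos (pi * x)\<bar>)
       else \<bar>a_coeff N x\<bar> / \<bar>cos (pi * x)\<bar>) = Gamma (N + 1/2 - x) * Gamma (N + 1/2 + x) / (pi * 2 ^ N * fact N)"
    (is "_ = ?B x")
proof (cases "cos (pi * x) = 0")
  case False
  then have "\<not> (\<exists>k :: int. odd k \<and> 2 * x = of_int k)" unfolding cos_pi_eq_0_iff .
  then show ?thesis using a_coeff_over_cos[OF x False] by (simp only: if_False)
next
  case True
  have "((\<lambda>x. \<bar>a_coeff N x\<bar> / \<bar>cos (pi * x)\<bar>) \<longlongrightarrow> ?B x) (at x)"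
  proof (rule Lim_transform_eventually)
    have "N + 1/2 - x \<notin> \<int>\<^sub>\<le>\<^sub>0" "N + 1/2 + x \<notin> \<int>\<^sub>\<le>\<^sub>0"
      using x by (auto elim!: nonpos_Ints_cases)
    then show "(?B \<longlongrightarrow> ?B x) (at x)"
      by (intro tendsto_intros) auto
    \<comment> \<open>Distinct zeros of cos (pi y) are at least 1 apart, so within 1/2 of
      \<open>x\<close> there is no other; the second interval keeps |y| < N + 1/2.\<close>
    have "eventually (\<lambda>y. y \<in> {x - 1/2<..<x + 1/2} \<inter> {- (N + 1/2)<..<N + 1/2}) (at x)"
      using x by (intro eventually_at_in_open') (auto simp: abs_less_iff)
    moreover have "eventually (\<lambda>y. y \<noteq> x) (at x)" by (simp add: eventually_at_filter)
    ultimately show "eventually (\<lambda>y. ?B y = \<bar>a_coeff N y\<bar> / \<bar>cos (pi * y)\<bar>) (at x)"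
    proof eventually_elim
      case (elim y)
      have "cos (pi * y) \<noteq> 0"
      proof
        assume "cos (pi * y) = 0"
        then obtain k k' :: int where k: "2 * y = of_int k" "2 * x = of_int k'"
          using True unfolding cos_pi_eq_0_iff by blast
        have xy: "x - 1/2 < y" "y < x + 1/2" "y \<noteq> x" using elim by auto
        then have "of_int k < of_int k' + (1 :: real)" "of_int k' < of_int k + (1 :: real)"
          using k by linarith+
        moreover have "k \<noteq> k'" using k xy(3) by force
        ultimately have "of_int k < (of_int (k' + 1) :: real)" "of_int k' < (of_int (k + 1) :: real)" "k \<noteq> k'" by simp_all
        then show False by linarith
      qed
      then show ?case using elim by (intro a_coeff_over_cos[symmetric]) auto
    qed
  qed
  then have "Lim (at x) (\<lambda>x. \<bar>a_coeff N x\<bar> / \<bar>cos (pi * x)\<bar>) = ?B x"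
    by (intro tendsto_Lim) auto
  then show ?thesis using True unfolding cos_pi_eq_0_iff by (simp only: if_True)
qed

lemma integral_real_kernel_sign:
  fixes m n X :: real
  assumes "\<bar>m\<bar> < N + 1/2" "n > N - 1/2" "X > 0"
  shows "(- 1) ^ N * (\<integral>x. real_kernel N m n X x \<partial>octant) > 0"
proof -
  let ?f = "\<lambda>x. (- 1) ^ N * real_kernel N m n X x"
  have int: "integrable octant ?f"
    using assms by (intro integrable_mult_right integrable_real_kernel) auto
  have pos: "?f x > 0" if x: "x \<in> space octant" for x
  proof -
    obtain s v u where x: "x = (s, v, u)" and "s > 0" "v > 0" "u > 0"
      using x by (auto simp: space_octant)
    then have "(- 1) ^ N * exp_rem N (u * s / v * X) > 0"
      using assms by (intro exp_rem_sign) simp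
    moreover have "?f x = exp ((- 1/2 - m) * ln s + (n - 1/2) * ln v + (m - 1/2) * ln u - (s + v + u)) *
        ((- 1) ^ N * exp_rem N (u * s / v * X))"
      by (simp add: x real_kernel_def)
    ultimately show ?thesis by (simp only: mult_pos_pos exp_gt_zero)
  qed
  have "(\<integral>x. ?f x \<partial>octant) \<noteq> 0"
  proof
    assume "(\<integral>x. ?f x \<partial>octant) = 0"
    moreover have "AE x in octant. 0 \<le> ?f x"
      using pos by (intro AE_I2 less_imp_le)
    ultimately have "AE x in octant. ?f x = 0"
      using integral_nonneg_eq_0_iff_AE[OF int] by blast
    \<comment> \<open>\<open>?f\<close> is positive everywhere, so if it vanished almost everywhere
      the octant would be a null set; the positive Gamma integral of the weight refutes
      this.\<close>
    then have "AE x in octant. gamma_weight N m n x = 0"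
      by (rule AE_mp) (use pos in \<open>fastforce intro!: AE_I2\<close>)
    then have "(\<integral>x. gamma_weight N m n x \<partial>octant) = 0" by (rule integral_eq_zero_AE)
    moreover have "Gamma (N + 1/2 - m) * Gamma (N + 1/2 + m) * Gamma (n - N + 1/2) > 0"
      using assms by (intro mult_pos_pos Gamma_real_pos) auto
    ultimately show False
      using has_bochner_integral_gamma_weight[OF assms(1,2)] by (auto simp: has_bochner_integral_iff)
  qed
  moreover have "(\<integral>x. ?f x \<partial>octant) \<ge> 0"
    using pos by (intro integral_nonneg_AE AE_I2) (auto intro: less_imp_le)
  ultimately have "(\<integral>x. ?f x \<partial>octant) > 0" by linarith
  then show ?thesis by simp
qed

theorem theorem3p2:
  fixes \<xi> \<mu> \<nu> :: complex and N :: nat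
  assumes "\<xi> \<in> D1"
    and "\<bar>Re \<mu>\<bar> < real N + 1 / 2"
    and "Re \<nu> > real N - 1 / 2"
  shows "\<exists>R :: complex.
    exp (- (of_real pi * \<i> * \<mu>)) * legendre_Q \<nu> \<mu> (cosh \<xi>) =
      csqrt (of_real pi / (2 * sinh \<xi>)) * exp (- ((\<nu> + 1 / 2) * \<xi>)) / Gamma (\<nu> - \<mu> + 1) *
      ((\<Sum>n<N. a_coeff n \<mu> * Gamma (\<nu> - of_nat n + 1 / 2) * (exp \<xi> / sinh \<xi>) ^ n) + R) \<and>
    norm R \<le>
      norm (cos (of_real pi * \<mu>)) *
      (if \<exists>k :: int. odd k \<and> 2 * Re \<mu> = of_int k
       then Lim (at (Re \<mu>)) (\<lambda>x. \<bar>a_coeff N x\<bar> / \<bar>cos (pi * x)\<bar>)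
       else \<bar>a_coeff N (Re \<mu>)\<bar> / \<bar>cos (pi * Re \<mu>)\<bar>) *
      Gamma (Re \<nu> - real N + 1 / 2) * norm (exp \<xi> / sinh \<xi>) ^ N \<and>
    (\<xi> \<in> \<real> \<and> Re \<xi> > 0 \<and> \<mu> \<in> \<real> \<and> \<nu> \<in> \<real> \<longrightarrow>
      (let T = a_coeff N \<mu> * Gamma (\<nu> - of_nat N + 1 / 2) * (exp \<xi> / sinh \<xi>) ^ N
       in R \<in> \<real> \<and> norm R \<le> norm T \<and> sgn (Re R) = sgn (Re T)))"
proof -
  define q where "q = exp (- (2 * \<xi>))"
  define X where "X = 1 / (1 - q)"
  define R where "R = cos (of_real pi * \<mu>) / of_real pi * remainder_integral N \<mu> \<nu> X"
  \<comment> \<open>Common value of both branches of the \<open>if\<close> in the bound, by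
    \<open>limiting_coefficient\<close>.\<close>
  define B where "B = Gamma (N + 1/2 - Re \<mu>) * Gamma (N + 1/2 + Re \<mu>) / (pi * 2 ^ N * fact N)"
  have q: "norm q < 1" unfolding q_def by (rule norm_exp_D1[OF assms(1)])
  have "Re (1 - q) \<ge> 0" using q abs_Re_le_cmod[of q] by simp
  then have X_Re: "Re X \<ge> 0"
    by (simp add: X_def Re_divide del: minus_complex.simps)
  have "sinh \<xi> = exp \<xi> * ((1 - q) / 2)"
    by (simp add: q_def sinh_field_def algebra_simps flip: exp_add)
  then have ratio: "exp \<xi> / sinh \<xi> = 2 / (1 - q)" by (simp only:) simp
  then have ratio_X: "exp \<xi> / sinh \<xi> = 2 * X" by (simp add: X_def)
  have N: "real N \<ge> 0" by simp
  have \<nu>: "Re \<nu> > - 3/2" and nm: "Re (\<nu> - \<mu> + 1) > 0"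
    using assms(2,3) N by (simp_all add: abs_less_iff)
  have "exp (- (of_real pi * \<i> * \<mu>)) * legendre_Q \<nu> \<mu> (cosh \<xi>) =
    csqrt (of_real pi / (2 * sinh \<xi>)) * exp (- ((\<nu> + 1 / 2) * \<xi>)) / Gamma (\<nu> - \<mu> + 1) * connection_rhs N \<mu> \<nu> q"
    unfolding legendre_Q_cosh[OF assms(1) \<nu> nm] using connection_formula[OF assms(2,3) q] by (simp only: q_def)
  then have expansion: "exp (- (of_real pi * \<i> * \<mu>)) * legendre_Q \<nu> \<mu> (cosh \<xi>) =
      csqrt (of_real pi / (2 * sinh \<xi>)) * exp (- ((\<nu> + 1 / 2) * \<xi>)) / Gamma (\<nu> - \<mu> + 1) *
      ((\<Sum>n<N. a_coeff n \<mu> * Gamma (\<nu> - of_nat n + 1 / 2) * (exp \<xi> / sinh \<xi>) ^ n) + R)"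
    unfolding connection_rhs_def R_def X_def ratio .
  have "norm R = norm (cos (of_real pi * \<mu>)) / pi * norm (remainder_integral N \<mu> \<nu> X)"
    by (simp add: R_def norm_mult norm_divide)
  also have "\<dots> \<le> norm (cos (of_real pi * \<mu>)) / pi * (norm X ^ N / fact N *
      (Gamma (N + 1/2 - Re \<mu>) * Gamma (N + 1/2 + Re \<mu>) * Gamma (Re \<nu> - N + 1/2)))"
    by (intro mult_left_mono norm_remainder_integral_le assms X_Re) auto
  also have "\<dots> = norm (cos (of_real pi * \<mu>)) * B * Gamma (Re \<nu> - N + 1/2) * norm (exp \<xi> / sinh \<xi>) ^ N"
    unfolding ratio_X by (simp add: B_def norm_mult power_mult_distrib field_simps)
  finally have bound: "norm R \<le> norm (cos (of_real pi * \<mu>)) * B * Gamma (Re \<nu> - N + 1/2) * norm (exp \<xi> / sinh \<xi>) ^ N" .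
  have real_case: "R \<in> \<real> \<and> norm R \<le> norm T \<and> sgn (Re R) = sgn (Re T)"
    if real: "\<xi> \<in> \<real>" "Re \<xi> > 0" "\<mu> \<in> \<real>" "\<nu> \<in> \<real>"
      and T: "T = a_coeff N \<mu> * Gamma (\<nu> - of_nat N + 1 / 2) * (exp \<xi> / sinh \<xi>) ^ N" for T
  proof -
    obtain m n x where mnx: "\<mu> = of_real m" "\<nu> = of_real n" "\<xi> = of_real x"
      using real by (auto elim!: Reals_cases)
    define Y where "Y = 1 / (1 - exp (- (2 * x)))"
    have Y: "Y > 0" using real by (simp add: Y_def mnx)
    have XY: "X = of_real Y" by (simp add: X_def Y_def q_def mnx flip: exp_of_real)
    define I where "I = (\<integral>x. real_kernel N m n Y x \<partial>octant)"
    define t where "t = a_coeff N m * Gamma (n - N + 1/2) * (2 * Y) ^ N"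
    have cos_eq: "cos (of_real pi * \<mu>) = of_real (cos (pi * m))"
      by (simp add: mnx flip: cos_of_real)
    have R_eq: "R = of_real (cos (pi * m) / pi * I)"
      by (simp add: R_def XY mnx remainder_integral_of_real I_def flip: cos_of_real)
    have a_of_real: "complex_of_real (a_coeff N m) = a_coeff N (of_real m)"
      by (simp add: a_coeff_def)
    have T_eq: "T = of_real t"
      unfolding T t_def ratio_X by (simp add: XY mnx a_of_real flip: Gamma_complex_of_real)
    have B: "B > 0"
      using assms(2) unfolding B_def by (intro divide_pos_pos mult_pos_pos Gamma_real_pos) auto
    have G: "Gamma (n - N + 1/2) > 0" using assms(3) by (intro Gamma_real_pos) (simp add: mnx)
    have a: "a_coeff N m = (- 1) ^ N * cos (pi * m) * B"
      using a_coeff_eq_Gamma[of m N] assms(2) by (simp add: mnx B_def)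
    have "norm R \<le> norm T"
    proof -
      \<comment> \<open>For real parameters the general bound equals the modulus of the first
        neglected term.\<close>
      have "norm T = \<bar>cos (pi * m)\<bar> * B * Gamma (n - N + 1/2) * (2 * Y) ^ N"
        unfolding T_eq t_def a norm_of_real using B G Y by (simp add: abs_mult power_abs)
      also have "\<dots> = norm (cos (of_real pi * \<mu>)) * B * Gamma (Re \<nu> - N + 1/2) * norm (exp \<xi> / sinh \<xi>) ^ N"
        unfolding ratio_X cos_eq norm_of_real using Y by (simp add: XY mnx norm_mult)
      finally show ?thesis using bound by simp
    qed
    moreover have "sgn (Re R) = sgn (Re T)"
    proof -
      have "(- 1) ^ N * I > 0"
        unfolding I_def using assms(2,3) Y by (intro integral_real_kernel_sign) (simp_all add: mnx)
      then have "sgn I = (- 1) ^ N"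
        by (cases "even N") auto
      \<comment> \<open>Both a_N(m) and cos (pi m) times the remainder integral have the sign of
        (-1)^N cos (pi m); when the cosine vanishes, R and T are both zero.\<close>
      then have "sgn (Re R) = sgn (cos (pi * m)) * (- 1) ^ N"
        unfolding R_eq by (simp add: sgn_mult sgn_divide)
      also have "\<dots> = sgn ((- 1) ^ N) * sgn (cos (pi * m)) * sgn B * sgn (Gamma (n - N + 1/2)) * sgn ((2 * Y) ^ N)"
        using B G Y by (cases "even N") simp_all
      also have "\<dots> = sgn (Re T)"
        unfolding T_eq t_def a Re_complex_of_real by (simp only: sgn_mult)
      finally show ?thesis .
    qed
    ultimately show ?thesis by (simp add: R_eq)
  qed
  show ?thesis
    unfolding limiting_coefficient[OF assms(2)] Let_def B_def[symmetric]
  proof (intro exI[of _ R] conjI impI expansion bound)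
    assume real: "\<xi> \<in> \<real> \<and> Re \<xi> > 0 \<and> \<mu> \<in> \<real> \<and> \<nu> \<in> \<real>"
    let ?T = "a_coeff N \<mu> * Gamma (\<nu> - of_nat N + 1 / 2) * (exp \<xi> / sinh \<xi>) ^ N"
    from real_case[OF _ _ _ _ refl] real
    show "R \<in> \<real>" "norm R \<le> norm ?T" "sgn (Re R) = sgn (Re ?T)"
      by blast+
  qed
qed

end
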